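(* Let $\mathcal{P}=(P,\Delta)$ be a $k$-RPDS, let $\mathit{At}$ be a finite set, and for each $A\in\mathit{At}$ let $\mathcal{A}_A=(Q_A,P,\xi_A,\delta_A)$ be a $k$-RA with set of initial states $P\subseteq Q_A$; all are equipped with the freshness semantics. Let $c_0\in\mathit{ID}_{\mathcal{P}}$ be a proper ID with non-empty stack, and let $(d_0,\theta_0)\in D\times\Theta_k$ be the last (bottom-most) element of its stack. Let $\mathcal{P}'$ be the PDS constructed from $\mathcal{P}$, let $\mathcal{A}'_A$ be the NFA constructed from $\mathcal{A}_A$, and let $R_{\mathcal{P}}\subseteq\mathit{ID}_{\mathcal{P}}\times\mathit{ID}_{\mathcal{P}'}$ and $R_{\mathcal{A}_A}\subseteq\mathit{ID}_{\mathcal{A}_A}\times\mathit{ID}_{\mathcal{A}'_A}$ be the relations determined by $(d_0,\theta_0)$, all as defined in the context. Then $R_{\mathcal{P}}$ is a bisimulation relation between $\mathcal{P}$ and $\mathcal{P}'$, and for each $A\in\mathit{At}$, $R_{\mathcal{A}_A}$ is a bisimulation relation between the RA $\mathcal{A}_A$ and the NFA $\mathcal{A}'_A$.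
   Context: Let $D$ be a countably infinite set of data values, $[k]=\{1,\dots,k\}$, and $\Theta_k$ the set of assignments $\theta:[k]\to D$; an assignment is also regarded as the set of its values ($d\in\theta$ means $d=\theta(i)$ for some $i$). For a set $\Gamma$, $\mathrm{Com}(\Gamma)=\{\mathtt{pop},\mathtt{skip}\}\cup\{\mathtt{push}(\gamma)\mid\gamma\in\Gamma\}$. Stacks are words whose leftmost symbol is the top. **PDS and NFA.** A PDS over a finite stack alphabet $\Gamma$ is $(P',\Delta')$ with $P'$ finite and $\Delta'\subseteq P'\times\Gamma\times P'\times\mathrm{Com}(\Gamma)$, rules being written $(p,\gamma)\to(q,\mathit{com})$. IDs are elements of $P'\times\Gamma^*$; $(p,\gamma v)\Rightarrow(q,w)$ iff there is a rule $(p,\gamma)\to(q,\mathit{com})$ with $w=v$, $\gamma v$, or $\gamma'\gamma v$ according as $\mathit{com}=\mathtt{pop}$, $\mathtt{skip}$, or $\mathtt{push}(\gamma')$. An NFA is $(Q',I',F,\delta')$ where $(Q',\delta')$ is a PDS with only $\mathtt{pop}$ rules, $I'\subseteq Q'$ is the set of initial states and $F\subseteq Q'$ the set of final states; its IDs and transition relation are those of $(Q',\delta')$. **Equivalence relations.** $\Phi_k$ is the set of equivalence relations over the $2k+1$ symbols $\{\mathtt{x}_1,\dots,\mathtt{x}_k,\mathtt{x}'_1,\dots,\mathtt{x}'_k,\mathtt{x}_{\mathtt{top}}\}$. $(\theta,d,\theta')\models\phi$ means that $\phi$ is exactly the equality pattern obtained by interpreting $\mathtt{x}_i$ as $\theta(i)$,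 $\mathtt{x}'_i$ as $\theta'(i)$ and $\mathtt{x}_{\mathtt{top}}$ as $d$. $\Phi'_k$ is the set of equivalence relations over $\{\mathtt{x}_1,\dots,\mathtt{x}_k\}$; $\theta\models\psi$ for $\psi\in\Phi'_k$ means $\mathtt{x}_i\equiv_\psi\mathtt{x}_j\Leftrightarrow\theta(i)=\theta(j)$ for all $i,j\in[k]$. $\mathrm{lat}:\Phi_k\to\Phi'_k$ is defined by $\mathtt{x}_i\equiv_{\mathrm{lat}(\phi)}\mathtt{x}_j$ iff $\mathtt{x}'_i\equiv_\phi\mathtt{x}'_j$. **RPDS and RA (freshness semantics).** A $k$-RPDS is $\mathcal{P}=(P,\Delta)$ with $P$ a finite set of states and $\Delta\subseteq P\times\Phi_k\times P\times\mathrm{Com}([k])$, rules being written $(p,\phi)\to(q,\mathit{com})$. $\mathit{ID}_{\mathcal{P}}=P\times\Theta_k\times(D\times\Theta_k)^*$. $(p,\theta,(d,\theta'')u)\Rightarrow_{\mathcal{P}}(q,\theta',w)$ iff there is a rule $(p,\phi)\to(q,\mathit{com})\in\Delta$ with $(\theta,d,\theta')\models\phi$; for each $i\in[k]$, either $\theta'(i)\in\theta\cup\{d\}$ or $\theta'(i)$ occurs neither in $\theta''$ nor in any assignment (second component) of the stack cells of $u$; and $w=u$, $(d,\theta'')u$, or $(\theta'(j),\theta')(d,\theta'')u$ according as $\mathit{com}=\mathtt{pop}$, $\mathtt{skip}$, or $\mathtt{push}(j)$. A $k$-RA is $\mathcal{A}=(Q,I,\xi,\delta)$ where $(Q,\delta)$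 is a $k$-RPDS with only $\mathtt{pop}$ rules, $I\subseteq Q$ is the set of initial states, $\xi\subseteq Q\times\Phi'_k$; its IDs and transition relation are those of $(Q,\delta)$, and $\mathit{Acc}_{\mathcal{A}}=\{(p,\theta,\varepsilon)\mid\theta\models\psi\text{ for some }(p,\psi)\in\xi\}$. **Proper IDs.** An ID $(p,\theta_n,(d_{n-1},\theta_{n-1})\cdots(d_1,\theta_1))$ is proper if for all $i,j,l\in[n]$ with $i<j\le l$: $d_i\in\theta_i$; for all $m\in[k]$, $\theta_i(m)\notin\theta_j$ implies $\theta_i(m)\notin\theta_l$; and $d_i\notin\theta_j$ implies $d_i\notin\theta_l$. **Bisimulation.** A relation $R\subseteq\mathit{ID}_{\mathcal{P}}\times\mathit{ID}_{\mathcal{P}'}$ is a bisimulation relation between an RPDS $\mathcal{P}$ and a PDS $\mathcal{P}'$ if (1) whenever $c_1\Rightarrow_{\mathcal{P}}c_2$ and $(c_1,c'_1)\in R$, there is $c'_2$ with $c'_1\Rightarrow_{\mathcal{P}'}c'_2$ and $(c_2,c'_2)\in R$; (2) whenever $c'_1\Rightarrow_{\mathcal{P}'}c'_2$ and $(c_1,c'_1)\in R$, there is $c_2$ with $c_1\Rightarrow_{\mathcal{P}}c_2$ and $(c_2,c'_2)\in R$. It is a bisimulation relation between an RA $\mathcal{A}=(Q,I,\xi,\delta)$ and an NFA $\mathcal{A}'=(Q',I',F,\delta')$ if it is one between $(Q,\delta)$ and $(Q',\delta')$ and moreover (3) for all $(c,c')\in R$: $c\in\mathit{Acc}_{\mathcal{A}}$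 iff $c'=(q,\varepsilon)$ for some $q\in F$. **Composition.** For $\phi_1,\phi_2\in\Phi_k$: $\phi_1\odot\phi_2$ holds iff for all $i,j\in[k]$, $\mathtt{x}'_i\equiv_{\phi_1}\mathtt{x}'_j\Leftrightarrow\mathtt{x}_i\equiv_{\phi_2}\mathtt{x}_j$. $\phi_1\odot_{\mathtt T}\phi_2$ holds iff $\phi_1\odot\phi_2$ and for all $i\in[k]$, $\mathtt{x}'_i\equiv_{\phi_1}\mathtt{x}_{\mathtt{top}}\Leftrightarrow\mathtt{x}_i\equiv_{\phi_2}\mathtt{x}_{\mathtt{top}}$. If $\phi_1\odot\phi_2$, then $\phi_1\circ\phi_2\in\Phi_k$ is defined by: $\mathtt{x}_i\equiv\mathtt{x}_j$ iff $\mathtt{x}_i\equiv_{\phi_1}\mathtt{x}_j$ for $i,j\in[k]\cup\{\mathtt{top}\}$; $\mathtt{x}'_i\equiv\mathtt{x}'_j$ iff $\mathtt{x}'_i\equiv_{\phi_2}\mathtt{x}'_j$ for $i,j\in[k]$; and $\mathtt{x}_i\equiv\mathtt{x}'_j$ iff $\exists l\in[k]$ with $\mathtt{x}_i\equiv_{\phi_1}\mathtt{x}'_l$ and $\mathtt{x}_l\equiv_{\phi_2}\mathtt{x}'_j$, for $i\in[k]\cup\{\mathtt{top}\}$, $j\in[k]$. If $\phi_1\odot_{\mathtt T}\phi_2$, then $\phi_1\circ_{\mathtt T}\phi_2\in\Phi_k$ is defined in the same way except that $\mathtt{x}_i\equiv\mathtt{x}'_j$ iff ($\exists l\in[k]$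 with $\mathtt{x}_i\equiv_{\phi_1}\mathtt{x}'_l$ and $\mathtt{x}_l\equiv_{\phi_2}\mathtt{x}'_j$) or ($\mathtt{x}_i\equiv_{\phi_1}\mathtt{x}_{\mathtt{top}}$ and $\mathtt{x}_{\mathtt{top}}\equiv_{\phi_2}\mathtt{x}'_j$). For $\phi\in\Phi_k$, $j\in[k]$, $(\phi)^{=}_j\in\Phi_k$ is the equivalence relation such that for all $i,l\in[k]$: $\mathtt{x}_i\equiv\mathtt{x}_l$ iff $\mathtt{x}'_i\equiv_\phi\mathtt{x}'_l$; $\mathtt{x}_i\equiv\mathtt{x}_{\mathtt{top}}$ iff $\mathtt{x}'_i\equiv_\phi\mathtt{x}'_j$; and $\mathtt{x}_i\equiv\mathtt{x}'_i$. **Construction.** For a $k$-RPDS $\mathcal{P}=(P,\Delta)$, the PDS $\mathcal{P}'=(P\times\Phi_k,\Delta')$ has stack alphabet $\Phi_k$, and $\Delta'$ consists exactly of the following rules, for all $\phi_1,\phi_2,\phi_3\in\Phi_k$ with $\phi_1\odot\phi_2$ and $\phi_2\odot_{\mathtt T}\phi_3$: - $((q,\phi_2),\phi_1)\to((q',\phi_2\circ_{\mathtt T}\phi_3),\mathtt{skip})$ if $(q,\phi_3)\to(q',\mathtt{skip})\in\Delta$; - $((q,\phi_2),\phi_1)\to((q',\phi_1\circ(\phi_2\circ_{\mathtt T}\phi_3)),\mathtt{pop})$ if $(q,\phi_3)\to(q',\mathtt{pop})\in\Delta$; - $((q,\phi_2),\phi_1)\to((q',(\phi_3)^{=}_j),\mathtt{push}(\phi_2\circ_{\mathtt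 T}\phi_3))$ if $(q,\phi_3)\to(q',\mathtt{push}(j))\in\Delta$. The NFA $\mathcal{A}'_A$ is obtained by applying this construction to the base RPDS $(Q_A,\delta_A)$ of $\mathcal{A}_A$ (giving a PDS with $\mathtt{pop}$ rules only), with set of initial states $P\times\Phi_k$ and set of final states $\{(p,\phi)\in Q_A\times\Phi_k\mid(p,\mathrm{lat}(\phi))\in\xi_A\}$. **The relations.** Fix $(d_0,\theta_0)$, the bottom-most stack element of $c_0$. $R$ relates $(p,\theta_n,u)$ with $u=(d_{n-1},\theta_{n-1})\cdots(d_1,\theta_1)$ to $((p,\phi_n),v)$ with $v=\phi_{n-1}\cdots\phi_1$ (same $p$, same $n\ge1$) iff $(p,\theta_n,u)$ is proper, $(d_1,\theta_1)=(d_0,\theta_0)$ or $u=\varepsilon$, and $(\theta_{i-1},d_{i-1},\theta_i)\models\phi_i$ for all $i\in[n]$ (for $i=1$ this uses the fixed $(d_0,\theta_0)$). $R_{\mathcal{P}}$ is the restriction of $R$ to $\mathit{ID}_{\mathcal{P}}\times\mathit{ID}_{\mathcal{P}'}$ and $R_{\mathcal{A}_A}$ the restriction of $R$ to $\mathit{ID}_{\mathcal{A}_A}\times\mathit{ID}_{\mathcal{A}'_A}$. *)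

theory Defs
  imports "HOL-Library.FuncSet" "HOL-Library.Countable"
begin

section \<open>Pushdown systems and finite automata\<close>

datatype 'g com = Pop | Skip | Push 'g

definition Com :: "'g set \<Rightarrow> 'g com set" where
  "Com \<Gamma> = {Pop, Skip} \<union> Push ` \<Gamma>"

text \<open>Stacks are lists whose head is the top. The data domain is a type, so that only states,
  register indices and relations need explicit carriers.\<close>

record ('s, 'g) pds =
  pstates :: "'s set"
  prules :: "('s \<times> 'g \<times> 's \<times> 'g com) set"

record ('s, 'g) nfa = "('s, 'g) pds" +
  ninit :: "'s set"
  nfinal :: "'s set"

definition is_pds :: "'g set \<Rightarrow> ('s, 'g, 'z) pds_scheme \<Rightarrow> bool" where
  "is_pds \<Gamma> S \<longleftrightarrow> finite \<Gamma> \<and> finite (pstates S) \<and>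
     prules S \<subseteq> pstates S \<times> \<Gamma> \<times> pstates S \<times> Com \<Gamma>"

definition is_nfa :: "'g set \<Rightarrow> ('s, 'g) nfa \<Rightarrow> bool" where
  "is_nfa \<Gamma> A \<longleftrightarrow> is_pds \<Gamma> A \<and> (\<forall>(p, g, q, c) \<in> prules A. c = Pop) \<and>
     ninit A \<subseteq> pstates A \<and> nfinal A \<subseteq> pstates A"

definition pds_ID :: "'g set \<Rightarrow> ('s, 'g, 'z) pds_scheme \<Rightarrow> ('s \<times> 'g list) set" where
  "pds_ID \<Gamma> S = pstates S \<times> lists \<Gamma>"

definition pds_step ::
  "'g set \<Rightarrow> ('s, 'g, 'z) pds_scheme \<Rightarrow> 's \<times> 'g list \<Rightarrow> 's \<times> 'g list \<Rightarrow> bool" where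
  "pds_step \<Gamma> S c c' \<longleftrightarrow> c \<in> pds_ID \<Gamma> S \<and> c' \<in> pds_ID \<Gamma> S \<and>
     (\<exists>p g v q w com. c = (p, g # v) \<and> c' = (q, w) \<and> (p, g, q, com) \<in> prules S \<and>
        w = (case com of Pop \<Rightarrow> v | Skip \<Rightarrow> g # v | Push g' \<Rightarrow> g' # g # v))"

section \<open>Assignments and equivalence relations over register symbols\<close>

text \<open>Register indices are the natural numbers in \<open>{1..k}\<close>; assignments are extensional, so
  that equality of assignments is equality on \<open>{1..k}\<close>.\<close>

type_synonym 'd asg = "nat \<Rightarrow> 'd"

definition Theta :: "nat \<Rightarrow> 'd asg set" where
  "Theta k = {1..k} \<rightarrow>\<^sub>E UNIV"

definition vals :: "nat \<Rightarrow> 'd asg \<Rightarrow> 'd set" where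
  "vals k \<theta> = \<theta> ` {1..k}"

datatype rsym = X nat | X' nat | Xtop

type_synonym eqrel = "(rsym \<times> rsym) set"

definition rsyms :: "nat \<Rightarrow> rsym set" where
  "rsyms k = X ` {1..k} \<union> X' ` {1..k} \<union> {Xtop}"

definition Phi :: "nat \<Rightarrow> eqrel set" where
  "Phi k = {\<phi>. equiv (rsyms k) \<phi>}"

definition Phi' :: "nat \<Rightarrow> eqrel set" where
  "Phi' k = {\<psi>. equiv (X ` {1..k}) \<psi>}"

fun interp :: "'d asg \<Rightarrow> 'd \<Rightarrow> 'd asg \<Rightarrow> rsym \<Rightarrow> 'd" where
  "interp \<theta> d \<theta>' (X i) = \<theta> i"
| "interp \<theta> d \<theta>' (X' i) = \<theta>' i"
| "interp \<theta> d \<theta>' Xtop = d"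

definition sat :: "nat \<Rightarrow> 'd asg \<Rightarrow> 'd \<Rightarrow> 'd asg \<Rightarrow> eqrel \<Rightarrow> bool" where
  "sat k \<theta> d \<theta>' \<phi> \<longleftrightarrow>
     \<phi> = {(a, b). a \<in> rsyms k \<and> b \<in> rsyms k \<and> interp \<theta> d \<theta>' a = interp \<theta> d \<theta>' b}"

definition sat' :: "nat \<Rightarrow> 'd asg \<Rightarrow> eqrel \<Rightarrow> bool" where
  "sat' k \<theta> \<psi> \<longleftrightarrow> (\<forall>i\<in>{1..k}. \<forall>j\<in>{1..k}. (X i, X j) \<in> \<psi> \<longleftrightarrow> \<theta> i = \<theta> j)"

definition lat :: "nat \<Rightarrow> eqrel \<Rightarrow> eqrel" where
  "lat k \<phi> = {(X i, X j) | i j. i \<in> {1..k} \<and> j \<in> {1..k} \<and> (X' i, X' j) \<in> \<phi>}"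

definition composable :: "nat \<Rightarrow> eqrel \<Rightarrow> eqrel \<Rightarrow> bool" where
  "composable k \<phi>1 \<phi>2 \<longleftrightarrow>
     (\<forall>i\<in>{1..k}. \<forall>j\<in>{1..k}. (X' i, X' j) \<in> \<phi>1 \<longleftrightarrow> (X i, X j) \<in> \<phi>2)"

definition composableT :: "nat \<Rightarrow> eqrel \<Rightarrow> eqrel \<Rightarrow> bool" where
  "composableT k \<phi>1 \<phi>2 \<longleftrightarrow> composable k \<phi>1 \<phi>2 \<and>
     (\<forall>i\<in>{1..k}. (X' i, Xtop) \<in> \<phi>1 \<longleftrightarrow> (X i, Xtop) \<in> \<phi>2)"

text \<open>The relation determined by its restriction \<open>E1\<close> to the symbols \<open>X i\<close>, \<open>Xtop\<close>, its
  restriction \<open>E2\<close> to the symbols \<open>X' j\<close>, and its pairs \<open>C\<close> between the two kinds.\<close>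

definition glue :: "nat \<Rightarrow> eqrel \<Rightarrow> eqrel \<Rightarrow> (rsym \<Rightarrow> nat \<Rightarrow> bool) \<Rightarrow> eqrel" where
  "glue k E1 E2 C = (let L = X ` {1..k} \<union> {Xtop} in
     {(a, b). a \<in> L \<and> b \<in> L \<and> (a, b) \<in> E1} \<union>
     {(X' i, X' j) | i j. i \<in> {1..k} \<and> j \<in> {1..k} \<and> (X' i, X' j) \<in> E2} \<union>
     {(a, X' j) | a j. a \<in> L \<and> j \<in> {1..k} \<and> C a j} \<union>
     {(X' j, a) | a j. a \<in> L \<and> j \<in> {1..k} \<and> C a j})"

text \<open>The two compositions are meaningful only for relations that are \<open>composable\<close>
  and \<open>composableT\<close>, respectively.\<close>

definition rel_comp :: "nat \<Rightarrow> eqrel \<Rightarrow> eqrel \<Rightarrow> eqrel" where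
  "rel_comp k \<phi>1 \<phi>2 = glue k \<phi>1 \<phi>2
     (\<lambda>a j. \<exists>l\<in>{1..k}. (a, X' l) \<in> \<phi>1 \<and> (X l, X' j) \<in> \<phi>2)"

definition rel_compT :: "nat \<Rightarrow> eqrel \<Rightarrow> eqrel \<Rightarrow> eqrel" where
  "rel_compT k \<phi>1 \<phi>2 = glue k \<phi>1 \<phi>2
     (\<lambda>a j. (\<exists>l\<in>{1..k}. (a, X' l) \<in> \<phi>1 \<and> (X l, X' j) \<in> \<phi>2) \<or>
            ((a, Xtop) \<in> \<phi>1 \<and> (Xtop, X' j) \<in> \<phi>2))"

text \<open>For \<open>\<phi> \<in> Phi k\<close> and \<open>j \<in> {1..k}\<close> there is exactly one such relation.\<close>

definition after_push :: "nat \<Rightarrow> eqrel \<Rightarrow> nat \<Rightarrow> eqrel" where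
  "after_push k \<phi> j = (THE \<rho>. \<rho> \<in> Phi k \<and>
     (\<forall>i\<in>{1..k}. \<forall>l\<in>{1..k}.
        ((X i, X l) \<in> \<rho> \<longleftrightarrow> (X' i, X' l) \<in> \<phi>) \<and>
        ((X i, Xtop) \<in> \<rho> \<longleftrightarrow> (X' i, X' j) \<in> \<phi>) \<and>
        (X i, X' i) \<in> \<rho>))"

section \<open>Register pushdown systems and register automata\<close>

record 's rpds =
  states :: "'s set"
  rules :: "('s \<times> eqrel \<times> 's \<times> nat com) set"

record 's ra = "'s rpds" +
  init :: "'s set"
  accept :: "('s \<times> eqrel) set"

definition is_rpds :: "nat \<Rightarrow> ('s, 'z) rpds_scheme \<Rightarrow> bool" where
  "is_rpds k S \<longleftrightarrow> finite (states S) \<and>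
     rules S \<subseteq> states S \<times> Phi k \<times> states S \<times> Com {1..k}"

definition is_ra :: "nat \<Rightarrow> 's ra \<Rightarrow> bool" where
  "is_ra k A \<longleftrightarrow> is_rpds k A \<and> (\<forall>(p, \<phi>, q, c) \<in> rules A. c = Pop) \<and>
     init A \<subseteq> states A \<and> accept A \<subseteq> states A \<times> Phi' k"

type_synonym ('s, 'd) rid = "'s \<times> 'd asg \<times> ('d \<times> 'd asg) list"

definition rpds_ID :: "nat \<Rightarrow> ('s, 'z) rpds_scheme \<Rightarrow> ('s, 'd) rid set" where
  "rpds_ID k S = states S \<times> Theta k \<times> lists (UNIV \<times> Theta k)"

definition rpds_step ::
  "nat \<Rightarrow> ('s, 'z) rpds_scheme \<Rightarrow> ('s, 'd) rid \<Rightarrow> ('s, 'd) rid \<Rightarrow> bool" where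
  "rpds_step k S c c' \<longleftrightarrow> c \<in> rpds_ID k S \<and> c' \<in> rpds_ID k S \<and>
     (\<exists>p \<theta> d \<theta>'' u q \<theta>' w \<phi> com.
        c = (p, \<theta>, (d, \<theta>'') # u) \<and> c' = (q, \<theta>', w) \<and>
        (p, \<phi>, q, com) \<in> rules S \<and> sat k \<theta> d \<theta>' \<phi> \<and>
        (\<forall>i\<in>{1..k}. \<theta>' i \<in> vals k \<theta> \<union> {d} \<or>
           (\<theta>' i \<notin> vals k \<theta>'' \<and> (\<forall>(e, \<tau>)\<in>set u. \<theta>' i \<notin> vals k \<tau>))) \<and>
        w = (case com of Pop \<Rightarrow> u | Skip \<Rightarrow> (d, \<theta>'') # u
             | Push j \<Rightarrow> (\<theta>' j, \<theta>') # (d, \<theta>'') # u))"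

definition Acc :: "nat \<Rightarrow> 's ra \<Rightarrow> ('s, 'd) rid set" where
  "Acc k A = {(p, \<theta>, []) | p \<theta>. \<theta> \<in> Theta k \<and> (\<exists>\<psi>. (p, \<psi>) \<in> accept A \<and> sat' k \<theta> \<psi>)}"

text \<open>In an ID \<open>(p, \<theta>\<^sub>n, u)\<close>, stack cells are numbered \<open>1, \<dots>, n - 1\<close> from the bottom, and
  \<open>\<theta>\<^sub>n\<close> is the current assignment.\<close>

definition proper :: "nat \<Rightarrow> ('s, 'd) rid \<Rightarrow> bool" where
  "proper k = (\<lambda>(p, \<theta>, u).
     let n = length u + 1;
         dat = (\<lambda>i. fst (rev u ! (i - 1)));
         asg = (\<lambda>i. (map snd (rev u) @ [\<theta>]) ! (i - 1))
     in \<forall>i\<in>{1..n}. \<forall>j\<in>{1..n}. \<forall>l\<in>{1..n}. i < j \<and> j \<le> l \<longrightarrow>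
          dat i \<in> vals k (asg i) \<and>
          (\<forall>m\<in>{1..k}. asg i m \<notin> vals k (asg j) \<longrightarrow> asg i m \<notin> vals k (asg l)) \<and>
          (dat i \<notin> vals k (asg j) \<longrightarrow> dat i \<notin> vals k (asg l)))"

section \<open>Bisimulation\<close>

definition bisim_rpds_pds ::
  "nat \<Rightarrow> 'g set \<Rightarrow> ('s, 'z) rpds_scheme \<Rightarrow> ('t, 'g, 'y) pds_scheme \<Rightarrow>
     (('s, 'd) rid \<times> ('t \<times> 'g list)) set \<Rightarrow> bool" where
  "bisim_rpds_pds k \<Gamma> S S' R \<longleftrightarrow>
     is_rpds k S \<and> is_pds \<Gamma> S' \<and> R \<subseteq> rpds_ID k S \<times> pds_ID \<Gamma> S' \<and>
     (\<forall>c1 c2 c1'. rpds_step k S c1 c2 \<and> (c1, c1') \<in> R \<longrightarrow>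
        (\<exists>c2'. pds_step \<Gamma> S' c1' c2' \<and> (c2, c2') \<in> R)) \<and>
     (\<forall>c1' c2' c1. pds_step \<Gamma> S' c1' c2' \<and> (c1, c1') \<in> R \<longrightarrow>
        (\<exists>c2. rpds_step k S c1 c2 \<and> (c2, c2') \<in> R))"

definition bisim_ra_nfa ::
  "nat \<Rightarrow> 'g set \<Rightarrow> 's ra \<Rightarrow> ('t, 'g) nfa \<Rightarrow>
     (('s, 'd) rid \<times> ('t \<times> 'g list)) set \<Rightarrow> bool" where
  "bisim_ra_nfa k \<Gamma> A A' R \<longleftrightarrow>
     is_ra k A \<and> is_nfa \<Gamma> A' \<and> bisim_rpds_pds k \<Gamma> A A' R \<and>
     (\<forall>(c, c') \<in> R. c \<in> Acc k A \<longleftrightarrow> (\<exists>q \<in> nfinal A'. c' = (q, [])))"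

section \<open>The construction and the relations\<close>

definition constr_rules ::
  "nat \<Rightarrow> ('s, 'z) rpds_scheme \<Rightarrow>
     (('s \<times> eqrel) \<times> eqrel \<times> ('s \<times> eqrel) \<times> eqrel com) set" where
  "constr_rules k S =
     {((q, \<phi>2), \<phi>1, (q', rel_compT k \<phi>2 \<phi>3), Skip) | q q' \<phi>1 \<phi>2 \<phi>3.
        \<phi>1 \<in> Phi k \<and> \<phi>2 \<in> Phi k \<and> \<phi>3 \<in> Phi k \<and> composable k \<phi>1 \<phi>2 \<and> composableT k \<phi>2 \<phi>3 \<and>
        (q, \<phi>3, q', Skip) \<in> rules S} \<union>
     {((q, \<phi>2), \<phi>1, (q', rel_comp k \<phi>1 (rel_compT k \<phi>2 \<phi>3)), Pop) | q q' \<phi>1 \<phi>2 \<phi>3.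
        \<phi>1 \<in> Phi k \<and> \<phi>2 \<in> Phi k \<and> \<phi>3 \<in> Phi k \<and> composable k \<phi>1 \<phi>2 \<and> composableT k \<phi>2 \<phi>3 \<and>
        (q, \<phi>3, q', Pop) \<in> rules S} \<union>
     {((q, \<phi>2), \<phi>1, (q', after_push k \<phi>3 j), Push (rel_compT k \<phi>2 \<phi>3)) | q q' \<phi>1 \<phi>2 \<phi>3 j.
        \<phi>1 \<in> Phi k \<and> \<phi>2 \<in> Phi k \<and> \<phi>3 \<in> Phi k \<and> composable k \<phi>1 \<phi>2 \<and> composableT k \<phi>2 \<phi>3 \<and>
        (q, \<phi>3, q', Push j) \<in> rules S}"

definition constr_pds :: "nat \<Rightarrow> 's rpds \<Rightarrow> ('s \<times> eqrel, eqrel) pds" where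
  "constr_pds k S = \<lparr>pstates = states S \<times> Phi k, prules = constr_rules k S\<rparr>"

definition constr_nfa :: "nat \<Rightarrow> 's ra \<Rightarrow> ('s \<times> eqrel, eqrel) nfa" where
  "constr_nfa k A = \<lparr>pstates = states A \<times> Phi k, prules = constr_rules k A,
     ninit = init A \<times> Phi k,
     nfinal = {(p, \<phi>). p \<in> states A \<and> \<phi> \<in> Phi k \<and> (p, lat k \<phi>) \<in> accept A}\<rparr>"

text \<open>Numbering as in \<open>proper\<close>, with the fixed pair \<open>(d0, \<theta>0)\<close> added at index \<open>0\<close>.
  When the stack is nonempty, its bottom cell, at index \<open>1\<close>, is this same pair.\<close>

definition bisim_rel :: "nat \<Rightarrow> 'd \<Rightarrow> 'd asg \<Rightarrow> (('s, 'd) rid \<times> (('s \<times> eqrel) \<times> eqrel list)) set" where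
  "bisim_rel k d0 \<theta>0 = {((p, \<theta>, u), ((p, \<phi>), v)) | p \<theta> u \<phi> v.
     length v = length u \<and> proper k (p, \<theta>, u) \<and> (u = [] \<or> last u = (d0, \<theta>0)) \<and>
     (let n = length u + 1;
          dat = (\<lambda>i. fst (((d0, \<theta>0) # rev u) ! i));
          asg = (\<lambda>i. (\<theta>0 # map snd (rev u) @ [\<theta>]) ! i);
          pat = (\<lambda>i. (rev v @ [\<phi>]) ! (i - 1))
      in \<forall>i\<in>{1..n}. sat k (asg (i - 1)) (dat (i - 1)) (asg i) (pat i))}"

definition R_rpds ::
  "nat \<Rightarrow> 'd \<Rightarrow> 'd asg \<Rightarrow> 's rpds \<Rightarrow> (('s, 'd) rid \<times> (('s \<times> eqrel) \<times> eqrel list)) set" where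
  "R_rpds k d0 \<theta>0 S = bisim_rel k d0 \<theta>0 \<inter> (rpds_ID k S \<times> pds_ID (Phi k) (constr_pds k S))"

definition R_ra ::
  "nat \<Rightarrow> 'd \<Rightarrow> 'd asg \<Rightarrow> 's ra \<Rightarrow> (('s, 'd) rid \<times> (('s \<times> eqrel) \<times> eqrel list)) set" where
  "R_ra k d0 \<theta>0 A = bisim_rel k d0 \<theta>0 \<inter> (rpds_ID k A \<times> pds_ID (Phi k) (constr_nfa k A))"

end

theory Submission imports Defs begin

text \<open>The second component of a related pair is a function of the first: it lists the equality
  patterns of consecutive stack assignments. So both simulation directions reduce to one fact: when
  the RPDS moves to a new assignment \<open>\<theta>'\<close>, the pattern of \<open>\<theta>'\<close> relative to the cell exposed by the
  move is the composition of the patterns of the adjacent pairs. The composition can only miss an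
  equality between \<open>\<theta>'\<close> and a deeper cell that is not witnessed by the assignment in between.
  Freshness excludes a value of \<open>\<theta>'\<close> that is new yet occurs deeper in the stack, and properness
  excludes a value that disappears and comes back. At the bottom of the stack the fixed pair
  \<open>(d0, \<theta>0)\<close> is a copy of cell 1, so there is nothing to exclude.
  Conversely, since the data domain is infinite,
  every pattern that is compatible with the current configuration is realised by an assignment
  whose new values avoid the whole stack.\<close>

section \<open>Equality patterns and their composition\<close>

text \<open>\<open>sat\<close> prescribes its relation completely. Naming that relation as a
  function turns every \<open>sat\<close> condition into an equation.\<close>

definition pattern :: "nat \<Rightarrow> 'd asg \<Rightarrow> 'd \<Rightarrow> 'd asg \<Rightarrow> eqrel" where
  "pattern k \<theta> d \<theta>' =
     {(a, b). a \<in> rsyms k \<and> b \<in> rsyms k \<and> interp \<theta> d \<theta>' a = interp \<theta> d \<theta>' b}"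

lemma sat_iff_pattern: "sat k \<theta> d \<theta>' \<phi> \<longleftrightarrow> \<phi> = pattern k \<theta> d \<theta>'"
  by (simp add: sat_def pattern_def)

lemma rsyms_simps [simp]:
  "X i \<in> rsyms k \<longleftrightarrow> i \<in> {1..k}" "X' i \<in> rsyms k \<longleftrightarrow> i \<in> {1..k}" "Xtop \<in> rsyms k"
  by (auto simp: rsyms_def)

lemma mem_pattern [simp]:
  "(a, b) \<in> pattern k \<theta> d \<theta>' \<longleftrightarrow>
     a \<in> rsyms k \<and> b \<in> rsyms k \<and> interp \<theta> d \<theta>' a = interp \<theta> d \<theta>' b"
  by (simp add: pattern_def)

lemma pattern_in_Phi: "pattern k \<theta> d \<theta>' \<in> Phi k"
  by (auto simp: Phi_def equiv_def refl_on_def sym_def trans_def)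

lemma finite_rsyms: "finite (rsyms k)"
  by (simp add: rsyms_def)

lemma PhiD:
  assumes "\<phi> \<in> Phi k"
  shows "\<phi> \<subseteq> rsyms k \<times> rsyms k" "a \<in> rsyms k \<Longrightarrow> (a, a) \<in> \<phi>"
    "(a, b) \<in> \<phi> \<Longrightarrow> (b, a) \<in> \<phi>" "(a, b) \<in> \<phi> \<Longrightarrow> (b, c) \<in> \<phi> \<Longrightarrow> (a, c) \<in> \<phi>"
  using assms unfolding Phi_def equiv_def refl_on_def
  by (auto dest: symD transD)

lemma Phi_cong:
  assumes "\<phi> \<in> Phi k" "(a, b) \<in> \<phi>"
  shows "(a, c) \<in> \<phi> \<longleftrightarrow> (b, c) \<in> \<phi>" "(c, a) \<in> \<phi> \<longleftrightarrow> (c, b) \<in> \<phi>"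
  using PhiD(4)[OF assms(1) assms(2)] PhiD(4)[OF assms(1) PhiD(3)[OF assms]]
    PhiD(4)[OF assms(1) _ assms(2)] PhiD(4)[OF assms(1) _ PhiD(3)[OF assms]]
  by blast+

lemma finite_Phi: "finite (Phi k)"
proof -
  have "Phi k \<subseteq> Pow (rsyms k \<times> rsyms k)"
    using PhiD(1) by blast
  then show ?thesis
    by (rule finite_subset) (simp add: finite_rsyms)
qed

lemma rsyms_cases:
  assumes "a \<in> rsyms k"
  obtains i where "i \<in> {1..k}" "a = X i" | i where "i \<in> {1..k}" "a = X' i" | "a = Xtop"
  using assms by (auto simp: rsyms_def)

section \<open>Glued relations and the composition of patterns\<close>

lemma mem_glue [simp]:
  "(X i, X j) \<in> glue k E1 E2 C \<longleftrightarrow> i \<in> {1..k} \<and> j \<in> {1..k} \<and> (X i, X j) \<in> E1"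
  "(X i, Xtop) \<in> glue k E1 E2 C \<longleftrightarrow> i \<in> {1..k} \<and> (X i, Xtop) \<in> E1"
  "(Xtop, X j) \<in> glue k E1 E2 C \<longleftrightarrow> j \<in> {1..k} \<and> (Xtop, X j) \<in> E1"
  "(Xtop, Xtop) \<in> glue k E1 E2 C \<longleftrightarrow> (Xtop, Xtop) \<in> E1"
  "(X' i, X' j) \<in> glue k E1 E2 C \<longleftrightarrow> i \<in> {1..k} \<and> j \<in> {1..k} \<and> (X' i, X' j) \<in> E2"
  "(X i, X' j) \<in> glue k E1 E2 C \<longleftrightarrow> i \<in> {1..k} \<and> j \<in> {1..k} \<and> C (X i) j"
  "(Xtop, X' j) \<in> glue k E1 E2 C \<longleftrightarrow> j \<in> {1..k} \<and> C Xtop j"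
  "(X' j, X i) \<in> glue k E1 E2 C \<longleftrightarrow> i \<in> {1..k} \<and> j \<in> {1..k} \<and> C (X i) j"
  "(X' j, Xtop) \<in> glue k E1 E2 C \<longleftrightarrow> j \<in> {1..k} \<and> C Xtop j"
  by (auto simp: glue_def)

lemma glue_subset: "glue k E1 E2 C \<subseteq> rsyms k \<times> rsyms k"
  by (auto simp: glue_def rsyms_def)

lemma rsym_rel_eqI:
  assumes "\<phi> \<subseteq> rsyms k \<times> rsyms k" "\<psi> \<subseteq> rsyms k \<times> rsyms k"
    and "\<And>a b. a \<in> rsyms k \<Longrightarrow> b \<in> rsyms k \<Longrightarrow> (a, b) \<in> \<phi> \<longleftrightarrow> (a, b) \<in> \<psi>"
  shows "\<phi> = \<psi>"
  using assms by auto

text \<open>Case distinction on the kinds of the two symbols. Pairs from a primed symbol back to an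
  unprimed one enter \<open>glue\<close> through the same \<open>C\<close>, so the last two premises
  settle both orientations.\<close>

lemma glue_eq_pattern:
  assumes "\<And>i j. i \<in> {1..k} \<Longrightarrow> j \<in> {1..k} \<Longrightarrow> (X i, X j) \<in> E1 \<longleftrightarrow> \<theta> i = \<theta> j"
    and "\<And>i. i \<in> {1..k} \<Longrightarrow> (X i, Xtop) \<in> E1 \<longleftrightarrow> \<theta> i = d"
    and "\<And>i. i \<in> {1..k} \<Longrightarrow> (Xtop, X i) \<in> E1 \<longleftrightarrow> d = \<theta> i"
    and "(Xtop, Xtop) \<in> E1"
    and "\<And>i j. i \<in> {1..k} \<Longrightarrow> j \<in> {1..k} \<Longrightarrow> (X' i, X' j) \<in> E2 \<longleftrightarrow> \<theta>' i = \<theta>' j"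
    and "\<And>i j. i \<in> {1..k} \<Longrightarrow> j \<in> {1..k} \<Longrightarrow> C (X i) j \<longleftrightarrow> \<theta> i = \<theta>' j"
    and "\<And>j. j \<in> {1..k} \<Longrightarrow> C Xtop j \<longleftrightarrow> d = \<theta>' j"
  shows "glue k E1 E2 C = pattern k \<theta> d \<theta>'"
proof (rule rsym_rel_eqI[OF glue_subset])
  show "pattern k \<theta> d \<theta>' \<subseteq> rsyms k \<times> rsyms k"
    by (auto simp: pattern_def)
  fix a b assume "a \<in> rsyms k" "b \<in> rsyms k"
  then show "(a, b) \<in> glue k E1 E2 C \<longleftrightarrow> (a, b) \<in> pattern k \<theta> d \<theta>'"
    by (elim rsyms_cases) (simp_all add: assms del: atLeastAtMost_iff One_nat_def, auto)
qed

text \<open>Every pair found by the composition is a true equality. Conversely, an equality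
  \<open>\<tau> i = \<theta>' j\<close> needs a witness in the middle: the premise puts this value
  into \<theta> or makes it \<open>d\<close>, which yields one of the two disjuncts of
  \<open>rel_compT\<close>.\<close>

lemma rel_compT_pattern:
  assumes "\<And>j. j \<in> {1..k} \<Longrightarrow> \<theta>' j \<in> vals k \<tau> \<Longrightarrow> \<theta>' j \<in> vals k \<theta> \<union> {d}"
  shows "rel_compT k (pattern k \<tau> d \<theta>) (pattern k \<theta> d \<theta>') = pattern k \<tau> d \<theta>'"
proof -
  have "(\<exists>l\<in>{1..k}. \<tau> i = \<theta> l \<and> \<theta> l = \<theta>' j) \<or> \<tau> i = d \<and> d = \<theta>' j"
    if "i \<in> {1..k}" "j \<in> {1..k}" "\<tau> i = \<theta>' j" for i j
  proof -
    have "\<theta>' j \<in> vals k \<tau>"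
      unfolding vals_def using that by (metis imageI)
    then show ?thesis
      using assms[of j] that by (fastforce simp: vals_def)
  qed
  then show ?thesis
    unfolding rel_compT_def
    by (intro glue_eq_pattern) (simp_all del: atLeastAtMost_iff One_nat_def, metis+)
qed

text \<open>The top symbol means \<open>e\<close> in the first pattern and \<open>d\<close> in the
  second, so an equality with \<open>e\<close> must also pass through a register of \<tau>. This is
  why the premise covers \<open>e\<close> besides the values of \<sigma>.\<close>

lemma rel_comp_pattern:
  assumes "\<And>j. j \<in> {1..k} \<Longrightarrow> \<theta>' j \<in> vals k \<sigma> \<union> {e} \<Longrightarrow> \<theta>' j \<in> vals k \<tau>"
  shows "rel_comp k (pattern k \<sigma> e \<tau>) (pattern k \<tau> d \<theta>') = pattern k \<sigma> e \<theta>'"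
proof -
  have "\<exists>l\<in>{1..k}. \<tau> l = \<theta>' j"
    if "j \<in> {1..k}" "\<theta>' j = e \<or> (\<exists>i\<in>{1..k}. \<sigma> i = \<theta>' j)" for j
  proof -
    have "\<theta>' j \<in> vals k \<sigma> \<union> {e}"
      using that unfolding vals_def by (metis UnI1 UnI2 imageI singletonI)
    then show ?thesis
      using assms[of j] that by (force simp: vals_def)
  qed
  then show ?thesis
    unfolding rel_comp_def
    by (intro glue_eq_pattern) (simp_all del: atLeastAtMost_iff One_nat_def, metis+)
qed

section \<open>The pattern created by a push\<close>

lemma after_push_unique:
  assumes "\<phi> \<in> Phi k" "j \<in> {1..k}"
  shows "\<exists>!\<rho>. \<rho> \<in> Phi k \<and>
     (\<forall>i\<in>{1..k}. \<forall>l\<in>{1..k}.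
        ((X i, X l) \<in> \<rho> \<longleftrightarrow> (X' i, X' l) \<in> \<phi>) \<and>
        ((X i, Xtop) \<in> \<rho> \<longleftrightarrow> (X' i, X' j) \<in> \<phi>) \<and>
        (X i, X' i) \<in> \<rho>)"
    (is "\<exists>!\<rho>. ?A \<rho>")
proof -
  \<comment> \<open>After the push, \<open>X i\<close> and \<open>X' i\<close> both carry the value
    formerly denoted by \<open>X' i\<close>, and \<open>Xtop\<close> carries that of
    \<open>X' j\<close>. Existence follows by pulling \<phi> back along this relabelling.\<close>
  define h where "h a = (case a of X i \<Rightarrow> i | X' i \<Rightarrow> i | Xtop \<Rightarrow> j)" for a
  define \<rho>0 where "\<rho>0 = {(a, b). a \<in> rsyms k \<and> b \<in> rsyms k \<and> (X' (h a), X' (h b)) \<in> \<phi>}"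
  have h: "h a \<in> {1..k}" if "a \<in> rsyms k" for a
    using that assms(2) by (elim rsyms_cases) (auto simp: h_def)
  have "\<rho>0 \<in> Phi k"
    unfolding Phi_def mem_Collect_eq
  proof (rule equivI)
    show "\<rho>0 \<subseteq> rsyms k \<times> rsyms k"
      by (auto simp: \<rho>0_def)
    show "refl_on (rsyms k) \<rho>0"
    proof (rule refl_onI)
      fix a assume "a \<in> rsyms k"
      then show "(a, a) \<in> \<rho>0"
        using h[of a] PhiD(2)[OF assms(1), of "X' (h a)"] by (simp add: \<rho>0_def)
    qed
    show "sym \<rho>0"
      by (rule symI) (simp add: \<rho>0_def PhiD(3)[OF assms(1)])
    show "trans \<rho>0"
      by (rule transI) (use PhiD(4)[OF assms(1)] in \<open>auto simp: \<rho>0_def\<close>)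
  qed
  then have ex: "?A \<rho>0"
    using PhiD(2)[OF assms(1)] by (auto simp: \<rho>0_def h_def)
  have "\<rho> = \<rho>0" if \<rho>: "?A \<rho>" for \<rho>
  proof (rule rsym_rel_eqI)
    have \<rho>': "\<rho> \<in> Phi k" using \<rho> by (rule conjunct1)
    have XX: "(X i, X l) \<in> \<rho> \<longleftrightarrow> (X' i, X' l) \<in> \<phi>" "(X i, Xtop) \<in> \<rho> \<longleftrightarrow> (X' i, X' j) \<in> \<phi>"
      "(X i, X' i) \<in> \<rho>" if "i \<in> {1..k}" "l \<in> {1..k}" for i l
      using conjunct2[OF \<rho>, rule_format, OF that] by simp_all
    show "\<rho> \<subseteq> rsyms k \<times> rsyms k" "\<rho>0 \<subseteq> rsyms k \<times> rsyms k"
      using PhiD(1)[OF \<rho>'] by (simp, auto simp: \<rho>0_def)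
    \<comment> \<open>Uniqueness: every symbol is forced into the class of some \<open>X i\<close>,
      and on those symbols \<rho> is prescribed by \<phi>.\<close>
    have *: "(a, X (h a)) \<in> \<rho>" if "a \<in> rsyms k" for a
      using that
    proof (cases rule: rsyms_cases)
      case 1
      then show ?thesis using PhiD(2)[OF \<rho>' that] by (simp add: h_def)
    next
      case (2 i)
      then show ?thesis using PhiD(3)[OF \<rho>' XX(3)[of i]] by (simp add: h_def)
    next
      case 3
      have "(X' j, X' j) \<in> \<phi>"
        using assms(2) by (intro PhiD(2)[OF assms(1)]) simp
      then show ?thesis
        using 3 PhiD(3)[OF \<rho>'] XX(2)[OF assms(2) assms(2)] by (simp add: h_def)
    qed
    fix a b assume ab: "a \<in> rsyms k" "b \<in> rsyms k"
    have "(a, b) \<in> \<rho> \<longleftrightarrow> (X (h a), X (h b)) \<in> \<rho>"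
      using Phi_cong(1)[OF \<rho>' *[OF ab(1)], of b] Phi_cong(2)[OF \<rho>' *[OF ab(2)], of "X (h a)"] by simp
    also have "\<dots> \<longleftrightarrow> (X' (h a), X' (h b)) \<in> \<phi>"
      by (rule XX(1)[OF h[OF ab(1)] h[OF ab(2)]])
    finally show "(a, b) \<in> \<rho> \<longleftrightarrow> (a, b) \<in> \<rho>0"
      using ab by (simp add: \<rho>0_def)
  qed
  with ex show ?thesis by (rule ex1I)
qed

lemma after_push_in_Phi:
  assumes "\<phi> \<in> Phi k" "j \<in> {1..k}"
  shows "after_push k \<phi> j \<in> Phi k"
  using theI'[OF after_push_unique[OF assms]] unfolding after_push_def by blast

text \<open>The pushed cell is \<open>(\<theta>' j, \<theta>')\<close> while \<theta>' stays the
  current assignment, so the pattern on top compares \<theta>' with itself.\<close>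

lemma after_push_pattern:
  assumes "j \<in> {1..k}"
  shows "after_push k (pattern k \<theta> d \<theta>') j = pattern k \<theta>' (\<theta>' j) \<theta>'"
  unfolding after_push_def
  by (rule the1_equality[OF after_push_unique[OF pattern_in_Phi assms]])
     (use assms in \<open>simp add: pattern_in_Phi\<close>)

text \<open>The four conditions say that \<open>C\<close> respects the classes of both relations and
  matches them one to one: a class of \<open>E1\<close> meets at most one class of primed symbols of
  \<open>E2\<close>, and vice versa. Gluing matched classes then preserves transitivity.\<close>

lemma glue_in_Phi:
  assumes E: "E1 \<in> Phi k" "E2 \<in> Phi k"
    and l: "\<And>a b j. (a, b) \<in> E1 \<Longrightarrow> C a j \<Longrightarrow> C b j"
      "\<And>a b j. C a j \<Longrightarrow> C b j \<Longrightarrow> (a, b) \<in> E1"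
    and r: "\<And>a i j. (X' i, X' j) \<in> E2 \<Longrightarrow> C a i \<Longrightarrow> C a j"
      "\<And>a i j. C a i \<Longrightarrow> C a j \<Longrightarrow> (X' i, X' j) \<in> E2"
  shows "glue k E1 E2 C \<in> Phi k"
  unfolding Phi_def mem_Collect_eq
proof (rule equivI)
  note E1 = PhiD[OF E(1)] and E2 = PhiD[OF E(2)]
  define L where "L = X ` {1..k} \<union> {Xtop}"
  let ?G = "glue k E1 E2 C"
  \<comment> \<open>\<open>X i\<close> and \<open>Xtop\<close> behave alike in \<open>glue\<close>;
    treating them as one kind leaves eight cases for transitivity.\<close>
  have cases: thesis
    if "a \<in> rsyms k" "a \<in> L \<Longrightarrow> thesis" "\<And>i. i \<in> {1..k} \<Longrightarrow> a = X' i \<Longrightarrow> thesis" for a thesis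
    using that by (auto simp: rsyms_def L_def)
  have G: "(a, b) \<in> ?G \<longleftrightarrow> (a, b) \<in> E1" if "a \<in> L" "b \<in> L" for a b
    using that by (auto simp: L_def)
  have GC: "(a, X' i) \<in> ?G \<longleftrightarrow> C a i" "(X' i, a) \<in> ?G \<longleftrightarrow> C a i"
    if "a \<in> L" "i \<in> {1..k}" for a i
    using that by (auto simp: L_def)
  have G': "(X' i, X' j) \<in> ?G \<longleftrightarrow> (X' i, X' j) \<in> E2" if "i \<in> {1..k}" "j \<in> {1..k}" for i j
    using that by simp
  show "?G \<subseteq> rsyms k \<times> rsyms k"
    by (rule glue_subset)
  show "refl_on (rsyms k) ?G"
    by (rule refl_onI, elim rsyms_cases) (auto intro: E1(2) E2(2))
  have s: "(b, a) \<in> ?G" if "(a, b) \<in> ?G" "a \<in> rsyms k" "b \<in> rsyms k" for a b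
    using that(2,3,1)
    by (elim cases) (simp_all add: G GC G' del: mem_glue atLeastAtMost_iff One_nat_def, blast intro: E1(3), blast intro: E2(3))
  then show "sym ?G"
    using glue_subset[of k E1 E2 C] unfolding sym_def by blast
  have t: "(a, c) \<in> ?G"
    if "(a, b) \<in> ?G" "(b, c) \<in> ?G" "a \<in> rsyms k" "b \<in> rsyms k" "c \<in> rsyms k" for a b c
    using that(3-5,1,2)
    by (elim cases)
      (simp_all add: G GC G' del: mem_glue atLeastAtMost_iff One_nat_def, (meson E1(3,4) E2(3,4) l r)+)
  then show "trans ?G"
    using glue_subset[of k E1 E2 C] unfolding trans_def by blast
qed

text \<open>Composability lets two witnesses \<open>l\<close> be exchanged: they are equivalent as
  primed symbols of \<phi>1 iff they are as unprimed symbols of \<phi>2. The argument is purely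
  relational because the rules of the PDS range over all composable relations, not only over
  patterns of configurations.\<close>

lemma rel_comp_in_Phi:
  assumes "\<phi>1 \<in> Phi k" "\<phi>2 \<in> Phi k" "composable k \<phi>1 \<phi>2"
  shows "rel_comp k \<phi>1 \<phi>2 \<in> Phi k"
proof -
  note E1 = PhiD[OF assms(1)] and E2 = PhiD[OF assms(2)]
  have c: "(X' i, X' j) \<in> \<phi>1 \<longleftrightarrow> (X i, X j) \<in> \<phi>2" if "i \<in> {1..k}" "j \<in> {1..k}" for i j
    using assms(3) that by (simp add: composable_def)
  show ?thesis
    unfolding rel_comp_def
    by (rule glue_in_Phi[OF assms(1,2)]; (elim bexE conjE)?; meson E1(3,4) E2(3,4) c)
qed

lemma rel_compT_in_Phi:
  assumes "\<phi>1 \<in> Phi k" "\<phi>2 \<in> Phi k" "composableT k \<phi>1 \<phi>2"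
  shows "rel_compT k \<phi>1 \<phi>2 \<in> Phi k"
proof -
  note E1 = PhiD[OF assms(1)] and E2 = PhiD[OF assms(2)]
  have c: "(X' i, X' j) \<in> \<phi>1 \<longleftrightarrow> (X i, X j) \<in> \<phi>2" "(X' i, Xtop) \<in> \<phi>1 \<longleftrightarrow> (X i, Xtop) \<in> \<phi>2"
    if "i \<in> {1..k}" "j \<in> {1..k}" for i j
    using assms(3) that by (simp_all add: composableT_def composable_def)
  show ?thesis
    unfolding rel_compT_def
    by (rule glue_in_Phi[OF assms(1,2)]; (elim bexE conjE disjE)?; meson E1(3,4) E2(3,4) c)
qed

text \<open>\<open>rel_compT\<close> keeps the unprimed part of its first argument. This makes the
  nested composition of the pop rules meaningful.\<close>

lemma composable_rel_compT:
  assumes "composable k \<phi>1 \<phi>2"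
  shows "composable k \<phi>1 (rel_compT k \<phi>2 \<phi>3)"
  using assms by (auto simp: composable_def rel_compT_def)

lemma composable_pattern: "composable k (pattern k \<sigma> e \<tau>) (pattern k \<tau> d \<theta>)"
  by (simp add: composable_def)

lemma composableT_pattern: "composableT k (pattern k \<tau> d \<theta>) (pattern k \<theta> d \<theta>')"
  by (simp add: composableT_def composable_def)

section \<open>Realising a pattern by a fresh assignment\<close>

text \<open>Here \<open>u\<close> is the whole stack with its top cell, so that the two freshness
  clauses of \<open>rpds_step\<close> for the top and for the rest become one.\<close>

definition fresh_asg :: "nat \<Rightarrow> 'd asg \<Rightarrow> 'd \<Rightarrow> ('d \<times> 'd asg) list \<Rightarrow> 'd asg \<Rightarrow> bool" where
  "fresh_asg k \<theta> d u \<theta>' \<longleftrightarrow>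
     (\<forall>i\<in>{1..k}. \<theta>' i \<in> vals k \<theta> \<union> {d} \<or> (\<forall>(e, \<sigma>)\<in>set u. \<theta>' i \<notin> vals k \<sigma>))"

lemma finite_vals: "finite (vals k \<theta>)"
  by (simp add: vals_def)

text \<open>A class of primed symbols that contains an old symbol, that is some \<open>X i\<close>
  or \<open>Xtop\<close>, must copy its value; \<open>L\<close> ensures that this is consistent. The
  other classes get pairwise distinct values outside \<open>F\<close>. The last argument of
  \<open>interp \<theta> d \<theta>\<close> is a placeholder, as old symbols read only \<theta> and
  \<open>d\<close>.\<close>

lemma ex_asg_avoiding:
  fixes \<theta> :: "'d asg"
  assumes inf: "infinite (UNIV :: 'd set)" and \<phi>: "\<phi> \<in> Phi k" and "finite F"
    and L: "\<And>a b. a \<in> X ` {1..k} \<union> {Xtop} \<Longrightarrow> b \<in> X ` {1..k} \<union> {Xtop} \<Longrightarrow>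
      (a, b) \<in> \<phi> \<longleftrightarrow> interp \<theta> d \<theta> a = interp \<theta> d \<theta> b"
  obtains \<theta>' where "\<theta>' \<in> Theta k" "\<phi> = pattern k \<theta> d \<theta>'"
    "\<And>i. i \<in> {1..k} \<Longrightarrow> \<theta>' i \<in> vals k \<theta> \<union> {d} \<or> \<theta>' i \<notin> F"
proof -
  note \<phi>D = PhiD[OF \<phi>]
  define L where "L = X ` {1..k} \<union> {Xtop}"
  note L = L[folded L_def]
  define V where "V = vals k \<theta> \<union> {d}"
  have V: "interp \<theta> d \<theta> a \<in> V" if "a \<in> L" for a
    using that by (auto simp: L_def V_def vals_def)
  \<comment> \<open>The new values must also avoid \<open>V\<close>; otherwise a class without old
    symbol could accidentally coincide with an old value.\<close>
  have "infinite (- (F \<union> V))"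
    using inf \<open>finite F\<close> finite_vals[of k \<theta>] by (simp add: V_def Compl_eq_Diff_UNIV)
  then obtain f :: "nat \<Rightarrow> 'd" where f: "inj f" "range f \<subseteq> - (F \<union> V)"
    using infinite_countable_subset by blast
  \<comment> \<open>\<open>r i\<close> represents the class of \<open>X' i\<close>; the classes without old symbol get the fresh values \<open>f (r i)\<close>.\<close>
  define r where "r i = (LEAST l. (X' l, X' i) \<in> \<phi>)" for i
  have r: "(X' (r i), X' i) \<in> \<phi>" if "i \<in> {1..k}" for i
    unfolding r_def using \<phi>D(2)[of "X' i"] that by (intro LeastI) simp
  have r_eq: "r i = r j \<longleftrightarrow> (X' i, X' j) \<in> \<phi>" if "i \<in> {1..k}" "j \<in> {1..k}" for i j
  proof
    show "(X' i, X' j) \<in> \<phi>" if "r i = r j"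
      using r[OF \<open>i \<in> _\<close>] r[OF \<open>j \<in> _\<close>] Phi_cong(1)[OF \<phi>] that by metis
    show "r i = r j" if "(X' i, X' j) \<in> \<phi>"
    proof -
      have "(X' l, X' i) \<in> \<phi> \<longleftrightarrow> (X' l, X' j) \<in> \<phi>" for l
        by (rule Phi_cong(2)[OF \<phi> that])
      then show ?thesis by (simp add: r_def)
    qed
  qed
  define old where "old i a \<longleftrightarrow> a \<in> L \<and> (a, X' i) \<in> \<phi>" for i a
  define \<theta>' where "\<theta>' = restrict (\<lambda>i. if \<exists>a. old i a
    then interp \<theta> d \<theta> (SOME a. old i a) else f (r i)) {1..k}"
  \<comment> \<open>The value is independent of the chosen old symbol: two old symbols in the class
    of \<open>X' i\<close> are equivalent, and \<open>L\<close> turns this into equality of their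
    values.\<close>
  have old: "\<theta>' i = interp \<theta> d \<theta> a" if "i \<in> {1..k}" "old i a" for i a
  proof -
    define b where "b = (SOME a. old i a)"
    have "old i b"
      unfolding b_def using that(2) by (rule someI)
    then have "(b, a) \<in> \<phi>" "a \<in> L" "b \<in> L"
      using that(2) Phi_cong(2)[OF \<phi>] unfolding old_def by metis+
    then have "interp \<theta> d \<theta> b = interp \<theta> d \<theta> a"
      using L by blast
    then show ?thesis
      using that by (auto simp: \<theta>'_def b_def)
  qed
  have new: "\<theta>' i = f (r i)" if "i \<in> {1..k}" "\<not> (\<exists>a. old i a)" for i
    using that by (auto simp: \<theta>'_def)
  have new': "f n \<notin> F" "f n \<notin> V" for n
    using f(2) by auto
  have LX': "(a, X' j) \<in> \<phi> \<longleftrightarrow> interp \<theta> d \<theta> a = \<theta>' j" if "a \<in> L" "j \<in> {1..k}" for a j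
  proof (cases "\<exists>b. old j b")
    case True
    then obtain b where b: "old j b" by blast
    then have "(a, X' j) \<in> \<phi> \<longleftrightarrow> (a, b) \<in> \<phi>"
      using Phi_cong(2)[OF \<phi>] unfolding old_def by blast
    then show ?thesis
      using L[OF that(1)] b old[OF that(2) b] by (auto simp: old_def)
  next
    case False
    \<comment> \<open>Both sides are false: no old symbol is equivalent to \<open>X' j\<close>, and
      the new value lies outside \<open>V\<close>.\<close>
    then show ?thesis
      using new[OF that(2) False] new'(2) V[OF that(1)] that(1) by (metis old_def)
  qed
  have XX': "(X' i, X' j) \<in> \<phi> \<longleftrightarrow> \<theta>' i = \<theta>' j" if "i \<in> {1..k}" "j \<in> {1..k}" for i j
  proof (cases "\<exists>b. old i b")
    case True
    then obtain b where b: "b \<in> L" "(b, X' i) \<in> \<phi>" by (auto simp: old_def)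
    then have "(X' i, X' j) \<in> \<phi> \<longleftrightarrow> (b, X' j) \<in> \<phi>"
      using Phi_cong(1)[OF \<phi>] by blast
    then show ?thesis
      using LX'[OF b(1)] b(2) that by auto
  next
    case False
    show ?thesis
    proof (cases "\<exists>b. old j b")
      case True
      then obtain b where b: "b \<in> L" "(b, X' j) \<in> \<phi>" by (auto simp: old_def)
      then have "(X' i, X' j) \<in> \<phi> \<longleftrightarrow> (b, X' i) \<in> \<phi>"
        using Phi_cong(2)[OF \<phi> b(2)] \<phi>D(3) by blast
      then show ?thesis
        using LX'[OF b(1)] b(2) that by auto
    next
      case False
      then show ?thesis
        using new[OF that(1)] new[OF that(2)] \<open>\<nexists>b. old i b\<close> r_eq[OF that] f(1)
        by (simp add: inj_eq)
    qed
  qed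
  have "\<phi> = pattern k \<theta> d \<theta>'"
  proof (rule rsym_rel_eqI[OF \<phi>D(1) PhiD(1)[OF pattern_in_Phi]])
    fix a b assume ab: "a \<in> rsyms k" "b \<in> rsyms k"
    have *: "(a \<in> L \<and> interp \<theta> d \<theta>' a = interp \<theta> d \<theta> a) \<or> (\<exists>i\<in>{1..k}. a = X' i)"
      if "a \<in> rsyms k" for a
      using that by (elim rsyms_cases) (auto simp: L_def)
    have "(a, b) \<in> \<phi> \<longleftrightarrow> interp \<theta> d \<theta>' a = interp \<theta> d \<theta>' b"
      using *[OF ab(1)] *[OF ab(2)]
    proof (elim disjE conjE bexE)
      fix i assume "i \<in> {1..k}" "a = X' i" "b \<in> L" "interp \<theta> d \<theta>' b = interp \<theta> d \<theta> b"
      then show ?thesis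
        using LX'[of b i] \<phi>D(3) by auto
    qed (simp_all add: L LX' XX' del: atLeastAtMost_iff One_nat_def)
    then show "(a, b) \<in> \<phi> \<longleftrightarrow> (a, b) \<in> pattern k \<theta> d \<theta>'"
      using ab by simp
  qed
  moreover have "\<theta>' \<in> Theta k"
    by (simp add: Theta_def \<theta>'_def)
  moreover have "\<theta>' i \<in> vals k \<theta> \<union> {d} \<or> \<theta>' i \<notin> F" if "i \<in> {1..k}" for i
    using old[OF that] new[OF that] V new' unfolding V_def[symmetric] old_def by metis
  ultimately show thesis
    using that by blast
qed

text \<open>Composability with the current pattern says that \<phi> describes the actual equalities
  among the values of \<theta> and \<open>d\<close>. The set to avoid consists of all register
  values stored in the stack, which is finite.\<close>

lemma ex_fresh_asg:
  fixes \<theta> :: "'d asg"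
  assumes "infinite (UNIV :: 'd set)" "\<phi> \<in> Phi k" "composableT k (pattern k \<tau> d \<theta>) \<phi>"
  obtains \<theta>' where "\<theta>' \<in> Theta k" "\<phi> = pattern k \<theta> d \<theta>'" "fresh_asg k \<theta> d u \<theta>'"
proof -
  note \<phi>D = PhiD[OF assms(2)]
  have XX: "(X i, X j) \<in> \<phi> \<longleftrightarrow> \<theta> i = \<theta> j" if "i \<in> {1..k}" "j \<in> {1..k}" for i j
    using assms(3) that by (simp add: composableT_def composable_def)
  have XT: "(X i, Xtop) \<in> \<phi> \<longleftrightarrow> \<theta> i = d" if "i \<in> {1..k}" for i
    using assms(3) that by (simp add: composableT_def)
  have TX: "(Xtop, X i) \<in> \<phi> \<longleftrightarrow> d = \<theta> i" if "i \<in> {1..k}" for i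
    using XT[OF that] \<phi>D(3)[of "X i" Xtop] \<phi>D(3)[of Xtop "X i"] by blast
  have TT: "(Xtop, Xtop) \<in> \<phi>"
    by (rule \<phi>D(2)) simp
  let ?F = "\<Union> ((\<lambda>(e, \<sigma>). vals k \<sigma>) ` set u)"
  have "finite ?F"
    by (auto simp: finite_vals)
  moreover have "(a, b) \<in> \<phi> \<longleftrightarrow> interp \<theta> d \<theta> a = interp \<theta> d \<theta> b"
    if "a \<in> X ` {1..k} \<union> {Xtop}" "b \<in> X ` {1..k} \<union> {Xtop}" for a b
    using that
    by (elim UnE imageE singletonE)
      (simp_all add: XX XT TX TT del: atLeastAtMost_iff One_nat_def)
  ultimately obtain \<theta>' where \<theta>': "\<theta>' \<in> Theta k" "\<phi> = pattern k \<theta> d \<theta>'"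
    "\<And>i. i \<in> {1..k} \<Longrightarrow> \<theta>' i \<in> vals k \<theta> \<union> {d} \<or> \<theta>' i \<notin> ?F"
    using ex_asg_avoiding[OF assms(1,2), of ?F \<theta> d] by metis
  have "fresh_asg k \<theta> d u \<theta>'"
    unfolding fresh_asg_def
  proof
    fix i assume "i \<in> {1..k}"
    then show "\<theta>' i \<in> vals k \<theta> \<union> {d} \<or> (\<forall>(e, \<sigma>)\<in>set u. \<theta>' i \<notin> vals k \<sigma>)"
      using \<theta>'(3)[of i] by auto
  qed
  with \<theta>'(1,2) show thesis
    by (rule that)
qed

section \<open>Proper IDs and the relation by recursion on the stack\<close>

text \<open>The recursion follows the stack from the top. Comparing the current assignment only with
  the cell directly below it suffices, since the conditions on deeper cells are those of the
  remaining stack.\<close>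

fun proper_stack :: "nat \<Rightarrow> 'd asg \<Rightarrow> ('d \<times> 'd asg) list \<Rightarrow> bool" where
  "proper_stack k \<theta> [] \<longleftrightarrow> True"
| "proper_stack k \<theta> ((d, \<tau>) # u) \<longleftrightarrow> d \<in> vals k \<tau> \<and>
     (\<forall>(e, \<sigma>)\<in>set u. vals k \<theta> \<inter> vals k \<sigma> \<subseteq> vals k \<tau>) \<and> proper_stack k \<tau> u"

text \<open>The head becomes the component of the control state and the tail the abstract stack. The
  fixed pair serves as the cell below the bottom.\<close>

fun patterns :: "nat \<Rightarrow> 'd \<Rightarrow> 'd asg \<Rightarrow> 'd asg \<Rightarrow> ('d \<times> 'd asg) list \<Rightarrow> eqrel list" where
  "patterns k d0 \<theta>0 \<theta> [] = [pattern k \<theta>0 d0 \<theta>]"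
| "patterns k d0 \<theta>0 \<theta> ((d, \<tau>) # u) = pattern k \<tau> d \<theta> # patterns k d0 \<theta>0 \<tau> u"

lemma length_patterns [simp]: "length (patterns k d0 \<theta>0 \<theta> u) = Suc (length u)"
  by (induction k d0 \<theta>0 \<theta> u rule: patterns.induct) auto

lemma patterns_in_Phi: "set (patterns k d0 \<theta>0 \<theta> u) \<subseteq> Phi k"
  by (induction k d0 \<theta>0 \<theta> u rule: patterns.induct) (auto simp: pattern_in_Phi)

lemma ball_atLeast1_iff: "(\<forall>i\<in>{1..Suc n}. P i) \<longleftrightarrow> (\<forall>i\<le>n. P (Suc i))"
proof -
  have "{1..Suc n} = Suc ` {..n}"
    by (simp add: image_Suc_atMost)
  then show ?thesis
    by (simp only: ball_simps atMost_iff Ball_def[of "{..n}"])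
qed

text \<open>The persistence clause for the datum of a cell is subsumed: the datum is a value of the
  assignment of the same cell.\<close>

lemma proper_iff:
  "proper k (p, \<theta>, u) \<longleftrightarrow>
     (\<forall>(d, \<tau>)\<in>set u. d \<in> vals k \<tau>) \<and>
     (\<forall>i j l. i < j \<longrightarrow> j \<le> l \<longrightarrow> l \<le> length u \<longrightarrow>
        vals k ((map snd (rev u) @ [\<theta>]) ! i) \<inter> vals k ((map snd (rev u) @ [\<theta>]) ! l)
          \<subseteq> vals k ((map snd (rev u) @ [\<theta>]) ! j))"
    (is "_ \<longleftrightarrow> ?D \<and> ?C")
proof -
  \<comment> \<open>Indices now start at 0, and \<open>A (length u)\<close> is the current
    assignment. There is no cell behind \<open>B (length u)\<close>; the guard \<open>i < j\<close>
    with \<open>j \<le> length u\<close> keeps it from being read.\<close>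
  define A where "A i = (map snd (rev u) @ [\<theta>]) ! i" for i
  define B where "B i = fst (rev u ! i)" for i
  have P: "proper k (p, \<theta>, u) \<longleftrightarrow>
    (\<forall>i\<le>length u. \<forall>j\<le>length u. \<forall>l\<le>length u. i < j \<and> j \<le> l \<longrightarrow> B i \<in> vals k (A i) \<and>
       (\<forall>m\<in>{1..k}. A i m \<notin> vals k (A j) \<longrightarrow> A i m \<notin> vals k (A l)) \<and>
       (B i \<notin> vals k (A j) \<longrightarrow> B i \<notin> vals k (A l)))"
    unfolding proper_def Let_def prod.case Suc_eq_plus1[symmetric] ball_atLeast1_iff A_def B_def
    by (simp only: diff_Suc_1 Suc_less_eq Suc_le_mono)
  have D: "?D \<longleftrightarrow> (\<forall>i<length u. B i \<in> vals k (A i))"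
  proof -
    have "?D \<longleftrightarrow> (\<forall>x\<in>set (rev u). fst x \<in> vals k (snd x))"
      by auto
    also have "\<dots> \<longleftrightarrow> (\<forall>i<length u. fst (rev u ! i) \<in> vals k (snd (rev u ! i)))"
      by (simp only: all_set_conv_all_nth length_rev)
    finally show ?thesis
      by (simp add: A_def B_def nth_append)
  qed
  show ?thesis
    unfolding P D A_def[symmetric]
  proof (intro iffI conjI allI impI)
    assume P: "\<forall>i\<le>length u. \<forall>j\<le>length u. \<forall>l\<le>length u. i < j \<and> j \<le> l \<longrightarrow> B i \<in> vals k (A i) \<and>
       (\<forall>m\<in>{1..k}. A i m \<notin> vals k (A j) \<longrightarrow> A i m \<notin> vals k (A l)) \<and>
       (B i \<notin> vals k (A j) \<longrightarrow> B i \<notin> vals k (A l))"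
    show "B i \<in> vals k (A i)" if "i < length u" for i
      using P[rule_format, of i "length u" "length u"] that by simp
    show "vals k (A i) \<inter> vals k (A l) \<subseteq> vals k (A j)" if "i < j" "j \<le> l" "l \<le> length u" for i j l
    proof
      fix x assume x: "x \<in> vals k (A i) \<inter> vals k (A l)"
      then obtain m where m: "m \<in> {1..k}" "x = A i m"
        by (auto simp: vals_def)
      have "\<forall>m\<in>{1..k}. A i m \<notin> vals k (A j) \<longrightarrow> A i m \<notin> vals k (A l)"
        using P[rule_format, of i j l] that by simp
      then show "x \<in> vals k (A j)"
        using m x by blast
    qed
  next
    fix i j l
    assume R: "(\<forall>i<length u. B i \<in> vals k (A i)) \<and>
      (\<forall>i j l. i < j \<longrightarrow> j \<le> l \<longrightarrow> l \<le> length u \<longrightarrow> vals k (A i) \<inter> vals k (A l) \<subseteq> vals k (A j))"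
      and ijl: "l \<le> length u" "i < j \<and> j \<le> l"
    show B: "B i \<in> vals k (A i)"
      using conjunct1[OF R] ijl by simp
    have I: "vals k (A i) \<inter> vals k (A l) \<subseteq> vals k (A j)"
      using conjunct2[OF R, rule_format, of i j l] ijl by simp
    show "B i \<notin> vals k (A l)" if "B i \<notin> vals k (A j)"
      using I B that by blast
    show "\<forall>m\<in>{1..k}. A i m \<notin> vals k (A j) \<longrightarrow> A i m \<notin> vals k (A l)"
    proof (intro ballI impI)
      fix m assume "m \<in> {1..k}" "A i m \<notin> vals k (A j)"
      then show "A i m \<notin> vals k (A l)"
        using I unfolding vals_def by blast
    qed
  qed
qed

section \<open>Contiguous occurrence of elements in lists of sets\<close>

definition interval_closed :: "'b set list \<Rightarrow> bool" where
  "interval_closed xs \<longleftrightarrow>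
     (\<forall>i j l. i < j \<longrightarrow> j \<le> l \<longrightarrow> l < length xs \<longrightarrow> xs ! i \<inter> xs ! l \<subseteq> xs ! j)"

text \<open>An element shared by \<open>s\<close> and an earlier set must already be in
  \<open>t\<close>; from there the condition on the list ending in \<open>t\<close> carries it
  through all positions in between.\<close>

lemma interval_closed_snoc:
  "interval_closed (xs @ [t, s]) \<longleftrightarrow> interval_closed (xs @ [t]) \<and> (\<forall>x\<in>set xs. s \<inter> x \<subseteq> t)"
proof (intro iffI conjI ballI)
  assume L: "interval_closed (xs @ [t, s])"
  show "interval_closed (xs @ [t])"
    unfolding interval_closed_def
  proof (intro allI impI)
    fix i j l assume ijl: "i < j" "j \<le> l" "l < length (xs @ [t])"
    then have "(xs @ [t, s]) ! i \<inter> (xs @ [t, s]) ! l \<subseteq> (xs @ [t, s]) ! j"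
      using L unfolding interval_closed_def by simp
    then show "(xs @ [t]) ! i \<inter> (xs @ [t]) ! l \<subseteq> (xs @ [t]) ! j"
      using ijl nth_append_left[of _ "xs @ [t]" "[s]"] by simp
  qed
  fix x assume "x \<in> set xs"
  then obtain i where "i < length xs" "x = xs ! i"
    by (metis in_set_conv_nth)
  moreover from this have
    "(xs @ [t, s]) ! i \<inter> (xs @ [t, s]) ! Suc (length xs) \<subseteq> (xs @ [t, s]) ! length xs"
    using L[unfolded interval_closed_def, rule_format, of i "length xs" "Suc (length xs)"] by simp
  ultimately show "s \<inter> x \<subseteq> t"
    by (auto simp: nth_append)
next
  assume R: "interval_closed (xs @ [t]) \<and> (\<forall>x\<in>set xs. s \<inter> x \<subseteq> t)"
  show "interval_closed (xs @ [t, s])"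
    unfolding interval_closed_def
  proof (intro allI impI)
    fix i j l assume ijl: "i < j" "j \<le> l" "l < length (xs @ [t, s])"
    have old: "(xs @ [t, s]) ! i \<inter> (xs @ [t, s]) ! m \<subseteq> (xs @ [t, s]) ! j"
      if "j \<le> m" "m < length (xs @ [t])" for m
    proof -
      have "(xs @ [t]) ! i \<inter> (xs @ [t]) ! m \<subseteq> (xs @ [t]) ! j"
        using R ijl(1) that unfolding interval_closed_def by blast
      then show ?thesis
        using ijl(1) that nth_append_left[of _ "xs @ [t]" "[s]"] by simp
    qed
    have s: "(xs @ [t, s]) ! Suc (length xs) = s" and t: "(xs @ [t, s]) ! length xs = t"
      by (simp_all add: nth_append)
    consider "l < length (xs @ [t])" | "l = j" | "l = Suc (length xs)" "j \<le> length xs"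
      using ijl by fastforce
    then show "(xs @ [t, s]) ! i \<inter> (xs @ [t, s]) ! l \<subseteq> (xs @ [t, s]) ! j"
    proof cases
      case 1
      then show ?thesis using old ijl by blast
    next
      case 2
      then show ?thesis by blast
    next
      case 3
      \<comment> \<open>The only case that involves the new set: pass from \<open>s\<close> to
        \<open>t\<close>, then from \<open>t\<close> to position \<open>j\<close> within the shorter
        list.\<close>
      then have "s \<inter> xs ! i \<subseteq> t" "(xs @ [t, s]) ! i = xs ! i"
        using R ijl by (simp_all add: nth_append)
      moreover have "(xs @ [t, s]) ! i \<inter> t \<subseteq> (xs @ [t, s]) ! j"
        using old[of "length xs"] 3 t by simp
      ultimately show ?thesis
        using 3 s by auto
    qed
  qed
qed

lemma proper_iff_proper_stack: "proper k (p, \<theta>, u) \<longleftrightarrow> proper_stack k \<theta> u"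
proof (induction u arbitrary: \<theta>)
  case Nil
  then show ?case by (simp add: proper_iff)
next
  case (Cons x u)
  obtain d \<tau> where x: "x = (d, \<tau>)" by fastforce
  have P: "proper k (p, \<theta>, u) \<longleftrightarrow> (\<forall>(d, \<tau>)\<in>set u. d \<in> vals k \<tau>) \<and>
    interval_closed (map (vals k) (map snd (rev u) @ [\<theta>]))" for \<theta> u
  proof -
    have "(vals k ((map snd (rev u) @ [\<theta>]) ! i) \<inter> vals k ((map snd (rev u) @ [\<theta>]) ! l)
          \<subseteq> vals k ((map snd (rev u) @ [\<theta>]) ! j)) \<longleftrightarrow>
      (map (vals k) (map snd (rev u) @ [\<theta>]) ! i \<inter> map (vals k) (map snd (rev u) @ [\<theta>]) ! l
          \<subseteq> map (vals k) (map snd (rev u) @ [\<theta>]) ! j)"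
      if "i < j" "j \<le> l" "l \<le> length u" for i j l
      using that by (simp del: map_append)
    then show ?thesis
      unfolding proper_iff interval_closed_def by (simp del: map_append map_map add: less_Suc_eq_le cong: imp_cong)
  qed
  have "interval_closed (map (vals k) (map snd (rev (x # u)) @ [\<theta>])) \<longleftrightarrow>
    interval_closed (map (vals k) (map snd (rev u) @ [\<tau>])) \<and>
    (\<forall>y\<in>set (map (vals k) (map snd (rev u))). vals k \<theta> \<inter> y \<subseteq> vals k \<tau>)"
    using interval_closed_snoc[of "map (vals k) (map snd (rev u))" "vals k \<tau>" "vals k \<theta>"]
    by (simp add: x)
  then show ?case
    using Cons[of \<tau>] unfolding P by (simp add: x case_prod_beta) blast
qed

text \<open>\<open>bisim_rel\<close> counts from the bottom, whereas \<open>patterns\<close>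
  recurses from the top. After reversal, entry \<open>i\<close> compares the assignments at
  positions \<open>i\<close> and \<open>Suc i\<close>, position 0 being the fixed pair.\<close>

lemma patterns_nth:
  assumes "i \<le> length u"
  shows "rev (patterns k d0 \<theta>0 \<theta> u) ! i =
    pattern k ((\<theta>0 # map snd (rev u) @ [\<theta>]) ! i) (fst (((d0, \<theta>0) # rev u) ! i))
      ((\<theta>0 # map snd (rev u) @ [\<theta>]) ! Suc i)"
  using assms
proof (induction u arbitrary: \<theta>)
  case Nil
  then show ?case by simp
next
  case (Cons x u)
  obtain d \<tau> where x: "x = (d, \<tau>)" by fastforce
  show ?case
  proof (cases "i \<le> length u")
    case True
    \<comment> \<open>Below the new top, the lists for \<open>x # u\<close> and for \<open>u\<close>
      agree, as they differ only in an appended last entry.\<close>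
    let ?L = "\<theta>0 # map snd (rev u) @ [\<tau>]"
    have L: "(\<theta>0 # map snd (rev (x # u)) @ [\<theta>]) ! m = ?L ! m" if "m \<le> Suc i" for m
      using True that nth_append_left[of m ?L "[\<theta>]"] by (simp add: x)
    have "((d0, \<theta>0) # rev (x # u)) ! i = ((d0, \<theta>0) # rev u) ! i"
      using True nth_append_left[of i "(d0, \<theta>0) # rev u" "[x]"] by simp
    moreover have "rev (patterns k d0 \<theta>0 \<theta> (x # u)) ! i = rev (patterns k d0 \<theta>0 \<tau> u) ! i"
      using True by (simp add: x nth_append_left)
    ultimately show ?thesis
      using Cons.IH[OF True, of \<tau>] L[of i] L[of "Suc i"] by (simp only: le_refl le_SucI)
  next
    case False
    then have "i = Suc (length u)"
      using Cons.prems by simp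
    then show ?thesis
      by (simp add: x nth_append)
  qed
qed

text \<open>Equal lengths and equal entries amount to one list equation. A simulation step then
  means recomputing \<open>patterns\<close> and preserving \<open>proper_stack\<close>.\<close>

lemma bisim_rel_iff:
  "((p, \<theta>, u), ((q, \<phi>), v)) \<in> bisim_rel k d0 \<theta>0 \<longleftrightarrow>
     p = q \<and> proper_stack k \<theta> u \<and> (u = [] \<or> last u = (d0, \<theta>0)) \<and> \<phi> # v = patterns k d0 \<theta>0 \<theta> u"
proof -
  have "length v = length u \<and> (\<forall>i\<in>{1..Suc (length u)}.
      sat k ((\<theta>0 # map snd (rev u) @ [\<theta>]) ! (i - 1)) (fst (((d0, \<theta>0) # rev u) ! (i - 1)))
        ((\<theta>0 # map snd (rev u) @ [\<theta>]) ! i) ((rev v @ [\<phi>]) ! (i - 1)))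
    \<longleftrightarrow> length v = length u \<and> (\<forall>i\<le>length u. rev (\<phi> # v) ! i = rev (patterns k d0 \<theta>0 \<theta> u) ! i)"
    unfolding ball_atLeast1_iff by (simp add: sat_iff_pattern patterns_nth del: nth_Cons_Suc)
  also have "\<dots> \<longleftrightarrow> rev (\<phi> # v) = rev (patterns k d0 \<theta>0 \<theta> u)"
    by (subst list_eq_iff_nth_eq) (auto simp: less_Suc_eq_le)
  also have "\<dots> \<longleftrightarrow> \<phi> # v = patterns k d0 \<theta>0 \<theta> u"
    by (rule rev_is_rev_conv)
  finally show ?thesis
    unfolding bisim_rel_def Let_def by (auto simp: proper_iff_proper_stack)
qed

section \<open>The bisimulation\<close>

text \<open>Abstract and concrete successors are both indexed by the command of the RPDS rule. This
  keeps the two systems aligned and lets one lemma treat the three families of rules.\<close>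

fun abs_succ ::
  "nat \<Rightarrow> 's \<Rightarrow> eqrel \<Rightarrow> eqrel \<Rightarrow> eqrel list \<Rightarrow> eqrel \<Rightarrow> nat com \<Rightarrow> ('s \<times> eqrel) \<times> eqrel list" where
  "abs_succ k q \<phi> \<psi> v \<phi>3 Skip = ((q, rel_compT k \<phi> \<phi>3), \<psi> # v)"
| "abs_succ k q \<phi> \<psi> v \<phi>3 Pop = ((q, rel_comp k \<psi> (rel_compT k \<phi> \<phi>3)), v)"
| "abs_succ k q \<phi> \<psi> v \<phi>3 (Push j) = ((q, after_push k \<phi>3 j), rel_compT k \<phi> \<phi>3 # \<psi> # v)"

fun conc_succ ::
  "'s \<Rightarrow> 'd asg \<Rightarrow> 'd \<times> 'd asg \<Rightarrow> ('d \<times> 'd asg) list \<Rightarrow> nat com \<Rightarrow> ('s, 'd) rid" where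
  "conc_succ q \<theta>' x u Skip = (q, \<theta>', x # u)"
| "conc_succ q \<theta>' x u Pop = (q, \<theta>', u)"
| "conc_succ q \<theta>' x u (Push j) = (q, \<theta>', (\<theta>' j, \<theta>') # x # u)"

lemma rpds_step_iff:
  "rpds_step k S c c' \<longleftrightarrow> c \<in> rpds_ID k S \<and> c' \<in> rpds_ID k S \<and>
     (\<exists>p \<theta> d \<tau> u q \<theta>' com. c = (p, \<theta>, (d, \<tau>) # u) \<and> c' = conc_succ q \<theta>' (d, \<tau>) u com \<and>
        (p, pattern k \<theta> d \<theta>', q, com) \<in> rules S \<and> fresh_asg k \<theta> d ((d, \<tau>) # u) \<theta>')"
proof -
  have *: "conc_succ q \<theta>' (d, \<tau>) u com = (q, \<theta>', case com of Pop \<Rightarrow> u | Skip \<Rightarrow> (d, \<tau>) # u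
      | Push j \<Rightarrow> (\<theta>' j, \<theta>') # (d, \<tau>) # u)" for q :: 's and \<theta>' :: "'d asg" and d \<tau> u com
    by (cases com) simp_all
  have fresh: "fresh_asg k \<theta> d ((d, \<tau>) # u) \<theta>' \<longleftrightarrow> (\<forall>i\<in>{1..k}. \<theta>' i \<in> vals k \<theta> \<union> {d} \<or>
      (\<theta>' i \<notin> vals k \<tau> \<and> (\<forall>(e, \<sigma>)\<in>set u. \<theta>' i \<notin> vals k \<sigma>)))" for \<theta> \<theta>' :: "'d asg" and d \<tau> u
    by (simp add: fresh_asg_def)
  show ?thesis
    unfolding rpds_step_def sat_iff_pattern * fresh by blast
qed

text \<open>Only rules and states of \<open>S'\<close> are fixed, so the result serves both
  \<open>constr_pds\<close> and \<open>constr_nfa\<close>.\<close>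

lemma pds_step_constr_iff:
  assumes "prules S' = constr_rules k S" "pstates S' = states S \<times> Phi k"
  shows "pds_step (Phi k) S' c c' \<longleftrightarrow> c \<in> pds_ID (Phi k) S' \<and> c' \<in> pds_ID (Phi k) S' \<and>
     (\<exists>p \<phi> \<psi> v q \<phi>3 com. c = ((p, \<phi>), \<psi> # v) \<and> c' = abs_succ k q \<phi> \<psi> v \<phi>3 com \<and>
        (p, \<phi>3, q, com) \<in> rules S \<and> \<phi>3 \<in> Phi k \<and> composable k \<psi> \<phi> \<and> composableT k \<phi> \<phi>3)"
    (is "?L \<longleftrightarrow> ?R")
proof
  assume L: ?L
  then obtain s g v q w com where st: "c = (s, g # v)" "c' = (q, w)" "(s, g, q, com) \<in> constr_rules k S"
    "w = (case com of Pop \<Rightarrow> v | Skip \<Rightarrow> g # v | Push g' \<Rightarrow> g' # g # v)"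
    unfolding pds_step_def assms(1) by blast
  from st(3) obtain p \<phi> \<phi>3 q' com' where
    "s = (p, \<phi>)" "(q, w) = abs_succ k q' \<phi> g v \<phi>3 com'" "(p, \<phi>3, q', com') \<in> rules S"
    "\<phi>3 \<in> Phi k" "composable k g \<phi>" "composableT k \<phi> \<phi>3"
    unfolding constr_rules_def
  proof (elim UnE CollectE exE conjE, goal_cases)
    case (1 p q' \<phi>1 \<phi>2 \<phi>3)
    from this(1)[of p \<phi>2 q' \<phi>3 Skip] this(2-) show ?case by (simp add: st(4))
  next
    case (2 p q' \<phi>1 \<phi>2 \<phi>3)
    from this(1)[of p \<phi>2 q' \<phi>3 Pop] this(2-) show ?case by (simp add: st(4))
  next
    case (3 p q' \<phi>1 \<phi>2 \<phi>3 j)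
    from this(1)[of p \<phi>2 q' \<phi>3 "Push j"] this(2-) show ?case by (simp add: st(4))
  qed
  moreover have "c \<in> pds_ID (Phi k) S'" "c' \<in> pds_ID (Phi k) S'"
    using L by (simp_all add: pds_step_def)
  ultimately show ?R
    using st(1,2) by blast
next
  assume R: ?R
  then obtain p \<phi> \<psi> v q \<phi>3 com where
    r: "c = ((p, \<phi>), \<psi> # v)" "c' = abs_succ k q \<phi> \<psi> v \<phi>3 com" "(p, \<phi>3, q, com) \<in> rules S"
    "\<phi>3 \<in> Phi k" "composable k \<psi> \<phi>" "composableT k \<phi> \<phi>3"
    by blast
  have ID: "c \<in> pds_ID (Phi k) S'" "c' \<in> pds_ID (Phi k) S'"
    using R by simp_all
  \<comment> \<open>The rules also ask that \<phi> and \<psi> lie in \<open>Phi k\<close>; this is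
    recovered from \<open>c\<close> being an ID.\<close>
  have Phi: "\<phi> \<in> Phi k" "\<psi> \<in> Phi k"
    using ID(1) r(1) assms(2) by (auto simp: pds_ID_def)
  have "\<exists>s w com'. abs_succ k q \<phi> \<psi> v \<phi>3 com = (s, w) \<and>
    ((p, \<phi>), \<psi>, s, com') \<in> constr_rules k S \<and>
    w = (case com' of Pop \<Rightarrow> v | Skip \<Rightarrow> \<psi> # v | Push g \<Rightarrow> g # \<psi> # v)"
  proof (cases com)
    case Skip
    have rl: "((p, \<phi>), \<psi>, (q, rel_compT k \<phi> \<phi>3), Skip) \<in> constr_rules k S"
      unfolding constr_rules_def
      by (rule UnI1, rule UnI1, rule CollectI, intro exI conjI) (rule refl Phi r(3)[unfolded Skip] r(4-6))+
    show ?thesis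
      unfolding Skip by (intro exI conjI, rule abs_succ.simps(1)) (rule rl, simp)
  next
    case Pop
    have rl: "((p, \<phi>), \<psi>, (q, rel_comp k \<psi> (rel_compT k \<phi> \<phi>3)), Pop) \<in> constr_rules k S"
      unfolding constr_rules_def
      by (rule UnI1, rule UnI2, rule CollectI, intro exI conjI) (rule refl Phi r(3)[unfolded Pop] r(4-6))+
    show ?thesis
      unfolding Pop by (intro exI conjI, rule abs_succ.simps(2)) (rule rl, simp)
  next
    case (Push j)
    have rl: "((p, \<phi>), \<psi>, (q, after_push k \<phi>3 j), Push (rel_compT k \<phi> \<phi>3)) \<in> constr_rules k S"
      unfolding constr_rules_def
      by (rule UnI2, rule CollectI, intro exI conjI) (rule refl Phi r(3)[unfolded Push] r(4-6))+
    show ?thesis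
      unfolding Push by (intro exI conjI, rule abs_succ.simps(3)) (rule rl, simp)
  qed
  then obtain s w com' where w: "c' = (s, w)" "((p, \<phi>), \<psi>, s, com') \<in> constr_rules k S"
    "w = (case com' of Pop \<Rightarrow> v | Skip \<Rightarrow> \<psi> # v | Push g \<Rightarrow> g # \<psi> # v)"
    unfolding r(2) by blast
  show ?L
    unfolding pds_step_def assms(1) by (intro conjI exI) (rule ID r(1) w)+
qed

text \<open>The core of both simulation directions. Patterns of deeper cells do not change, so only
  the topmost ones are recomputed: freshness supplies the witnesses for
  \<open>rel_compT_pattern\<close>, and after a pop properness supplies those for
  \<open>rel_comp_pattern\<close>.\<close>

lemma abs_succ_patterns:
  assumes ps: "proper_stack k \<theta> ((d, \<tau>) # u)" and last: "last ((d, \<tau>) # u) = (d0, \<theta>0)"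
    and fresh: "fresh_asg k \<theta> d ((d, \<tau>) # u) \<theta>'" and com: "com \<in> Com {1..k}"
    and \<psi>: "\<psi> # v = patterns k d0 \<theta>0 \<tau> u"
  shows "(conc_succ q \<theta>' (d, \<tau>) u com,
    abs_succ k q (pattern k \<tau> d \<theta>) \<psi> v (pattern k \<theta> d \<theta>') com) \<in> bisim_rel k d0 \<theta>0"
proof -
  have fresh': "\<theta>' j \<in> vals k \<theta> \<union> {d}"
    if "j \<in> {1..k}" "(e, \<sigma>) \<in> set ((d, \<tau>) # u)" "\<theta>' j \<in> vals k \<sigma>" for j e \<sigma>
    using fresh that unfolding fresh_asg_def by blast
  have d: "d \<in> vals k \<tau>" and ps': "proper_stack k \<tau> u"
    and int: "\<And>e \<sigma>. (e, \<sigma>) \<in> set u \<Longrightarrow> vals k \<theta> \<inter> vals k \<sigma> \<subseteq> vals k \<tau>"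
    using ps by auto
  \<comment> \<open>A value of \<theta>' occurring deeper is not fresh, so it is \<open>d\<close> or
    a value of \<theta>. In the first case it lies in \<tau> because cell data do; in the second
    because \<theta> satisfies the interval condition.\<close>
  have int': "vals k \<theta>' \<inter> vals k \<sigma> \<subseteq> vals k \<tau>" if "(e, \<sigma>) \<in> set u" for e \<sigma>
  proof
    fix x assume x: "x \<in> vals k \<theta>' \<inter> vals k \<sigma>"
    then obtain j where "j \<in> {1..k}" "x = \<theta>' j"
      by (auto simp: vals_def)
    then have "x \<in> vals k \<theta> \<union> {d}"
      using fresh'[of j e \<sigma>] that x by simp
    then show "x \<in> vals k \<tau>"
      using int[OF that] d x by blast
  qed
  have ps_skip: "proper_stack k \<theta>' ((d, \<tau>) # u)"
    using d ps' int' by auto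
  have compT: "rel_compT k (pattern k \<tau> d \<theta>) (pattern k \<theta> d \<theta>') = pattern k \<tau> d \<theta>'"
    by (rule rel_compT_pattern) (rule fresh'[of _ d \<tau>], auto)
  show ?thesis
  proof (cases com)
    case Skip
    then show ?thesis
      using ps_skip last \<psi> by (simp add: bisim_rel_iff compT del: proper_stack.simps)
  next
    case (Push j)
    then have j: "j \<in> {1..k}"
      using com by (auto simp: Com_def)
    then have "\<theta>' j \<in> vals k \<theta>'"
      by (simp add: vals_def)
    then have "proper_stack k \<theta>' ((\<theta>' j, \<theta>') # (d, \<tau>) # u)"
      using ps_skip by (simp only: proper_stack.simps) blast
    then show ?thesis
      using Push last \<psi> after_push_pattern[OF j, of \<theta> d \<theta>']
      by (simp add: bisim_rel_iff compT del: proper_stack.simps)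
  next
    case Pop
    show ?thesis
    proof (cases u)
      case Nil
      \<comment> \<open>The popped cell is the bottom one and equals the fixed pair, so \<psi>
        compares this pair with itself. Composing with \<psi> changes nothing, as \<open>d\<close>
        is a value of \<tau>.\<close>
      then have eq: "d = d0" "\<tau> = \<theta>0" "\<psi> = pattern k \<tau> d \<tau>" "v = []"
        using last \<psi> by auto
      have "rel_comp k (pattern k \<tau> d \<tau>) (pattern k \<tau> d \<theta>') = pattern k \<tau> d \<theta>'"
        by (rule rel_comp_pattern) (use d in auto)
      then show ?thesis
        using Pop Nil eq compT by (simp add: bisim_rel_iff)
    next
      case (Cons x u')
      obtain e \<sigma> where x: "x = (e, \<sigma>)" by fastforce
      have \<psi>v: "\<psi> = pattern k \<sigma> e \<tau>" "v = patterns k d0 \<theta>0 \<sigma> u'"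
        using \<psi> by (simp_all add: Cons x)
      have e: "e \<in> vals k \<sigma>"
        using ps' by (simp add: Cons x)
      have "rel_comp k (pattern k \<sigma> e \<tau>) (pattern k \<tau> d \<theta>') = pattern k \<sigma> e \<theta>'"
      proof (rule rel_comp_pattern)
        fix j assume "j \<in> {1..k}" "\<theta>' j \<in> vals k \<sigma> \<union> {e}"
        then have "\<theta>' j \<in> vals k \<theta>' \<inter> vals k \<sigma>"
          using e by (auto simp: vals_def)
        then show "\<theta>' j \<in> vals k \<tau>"
          using int'[of e \<sigma>] by (auto simp: Cons x)
      qed
      moreover have "proper_stack k \<theta>' u"
      proof -
        \<comment> \<open>Properness of the exposed stack in two hops: a common value of \<theta>'
          and \<rho> lies in \<tau>, hence in \<sigma>.\<close>
        have "vals k \<theta>' \<inter> vals k \<rho> \<subseteq> vals k \<sigma>" if "(f, \<rho>) \<in> set u'" for f \<rho>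
        proof -
          have "vals k \<tau> \<inter> vals k \<rho> \<subseteq> vals k \<sigma>"
            using ps' that by (auto simp: Cons x)
          moreover have "vals k \<theta>' \<inter> vals k \<rho> \<subseteq> vals k \<tau>"
            using int'[of f \<rho>] that by (simp add: Cons)
          ultimately show ?thesis by blast
        qed
        then show ?thesis
          using ps' e by (auto simp: Cons x)
      qed
      moreover have "last u = (d0, \<theta>0)"
        using last Cons by simp
      ultimately show ?thesis
        using Pop \<psi>v by (simp add: bisim_rel_iff compT Cons x del: proper_stack.simps)
    qed
  qed
qed

lemma bisim_rel_in_pds_ID:
  assumes "((p, \<theta>, u), ((q, \<phi>), v)) \<in> bisim_rel k d0 \<theta>0" "q \<in> states S"
    "pstates S' = states S \<times> Phi k"
  shows "((q, \<phi>), v) \<in> pds_ID (Phi k) S'"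
proof -
  have "set (\<phi> # v) \<subseteq> Phi k"
    using assms(1) patterns_in_Phi unfolding bisim_rel_iff by metis
  then show ?thesis
    using assms(2,3) by (auto simp: pds_ID_def)
qed

lemma constr_is_pds:
  assumes "is_rpds k S" "prules S' = constr_rules k S" "pstates S' = states S \<times> Phi k"
  shows "is_pds (Phi k) S'"
proof -
  have rules: "p \<in> states S" "q \<in> states S" "com \<in> Com {1..k}"
    if "(p, \<phi>, q, com) \<in> rules S" for p \<phi> q com
    using assms(1) that by (auto simp: is_rpds_def)
  have "constr_rules k S \<subseteq> (states S \<times> Phi k) \<times> Phi k \<times> (states S \<times> Phi k) \<times> Com (Phi k)"
    unfolding constr_rules_def
  proof (intro Un_least subsetI; elim CollectE exE conjE)
    fix x p q \<phi>1 \<phi>2 \<phi>3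
    assume *: "\<phi>1 \<in> Phi k" "\<phi>2 \<in> Phi k" "\<phi>3 \<in> Phi k" "composable k \<phi>1 \<phi>2" "composableT k \<phi>2 \<phi>3"
    note Phi = *(1,2) rel_compT_in_Phi[OF *(2,3,5)]
      rel_comp_in_Phi[OF *(1) rel_compT_in_Phi[OF *(2,3,5)] composable_rel_compT[OF *(4)]]
    show "x \<in> (states S \<times> Phi k) \<times> Phi k \<times> (states S \<times> Phi k) \<times> Com (Phi k)"
      if "x = ((p, \<phi>2), \<phi>1, (q, rel_compT k \<phi>2 \<phi>3), Skip)" "(p, \<phi>3, q, Skip) \<in> rules S"
      using Phi rules[OF that(2)] that(1) by (simp add: Com_def)
    show "x \<in> (states S \<times> Phi k) \<times> Phi k \<times> (states S \<times> Phi k) \<times> Com (Phi k)"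
      if "x = ((p, \<phi>2), \<phi>1, (q, rel_comp k \<phi>1 (rel_compT k \<phi>2 \<phi>3)), Pop)" "(p, \<phi>3, q, Pop) \<in> rules S"
      using Phi rules[OF that(2)] that(1) by (simp add: Com_def)
    show "x \<in> (states S \<times> Phi k) \<times> Phi k \<times> (states S \<times> Phi k) \<times> Com (Phi k)"
      if "x = ((p, \<phi>2), \<phi>1, (q, after_push k \<phi>3 j), Push (rel_compT k \<phi>2 \<phi>3))"
        "(p, \<phi>3, q, Push j) \<in> rules S" for j
    proof -
      have "j \<in> {1..k}"
        using rules(3)[OF that(2)] by (auto simp: Com_def)
      then show ?thesis
        using Phi rules[OF that(2)] that(1) after_push_in_Phi[OF *(3), of j] by (simp add: Com_def)
    qed
  qed
  then show ?thesis
    using assms finite_Phi by (simp add: is_pds_def is_rpds_def)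
qed

text \<open>Forwards, the abstract rule uses the pattern of the step taken, and composability is
  automatic for patterns. Backwards, \<open>ex_fresh_asg\<close> realises the given \<phi>3, which
  is where the infinite data domain enters. Both directions close with
  \<open>abs_succ_patterns\<close>.\<close>

lemma constr_bisim:
  fixes d0 :: 'd
  assumes inf: "infinite (UNIV :: 'd set)" and S: "is_rpds k S"
    and S': "prules S' = constr_rules k S" "pstates S' = states S \<times> Phi k"
  shows "bisim_rpds_pds k (Phi k) S S'
    (bisim_rel k d0 \<theta>0 \<inter> (rpds_ID k S \<times> pds_ID (Phi k) S'))"
    (is "bisim_rpds_pds _ _ _ _ ?R")
proof -
  have rules: "q \<in> states S" "com \<in> Com {1..k}" "\<phi> \<in> Phi k"
    if "(p, \<phi>, q, com) \<in> rules S" for p \<phi> q com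
    using S that by (auto simp: is_rpds_def)
  have related: "\<exists>\<psi> v'. v = \<psi> # v' \<and> p = q \<and> \<phi> = pattern k \<tau> d \<theta> \<and>
      \<psi> # v' = patterns k d0 \<theta>0 \<tau> u \<and> composable k \<psi> \<phi> \<and>
      proper_stack k \<theta> ((d, \<tau>) # u) \<and> last ((d, \<tau>) # u) = (d0, \<theta>0)"
    if "((p, \<theta>, (d, \<tau>) # u), ((q, \<phi>), v)) \<in> bisim_rel k d0 \<theta>0" for p q :: 's and \<theta> d \<tau> u \<phi> v
  proof -
    have v: "v = patterns k d0 \<theta>0 \<tau> u" "\<phi> = pattern k \<tau> d \<theta>"
      using that by (simp_all add: bisim_rel_iff)
    \<comment> \<open>For empty \<open>u\<close> the pair \<open>(e, \<sigma>)\<close> is the fixed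
      one, otherwise it is the next cell. In both cases the primed side is \<tau>, which gives
      composability with \<phi>.\<close>
    have "\<exists>\<sigma> e v'. v = pattern k \<sigma> e \<tau> # v'"
      unfolding v by (cases u) (auto, metis)
    then obtain \<sigma> e v' where "v = pattern k \<sigma> e \<tau> # v'"
      by blast
    then show ?thesis
      using that v by (auto simp: bisim_rel_iff composable_pattern)
  qed
  have succ_in: "(conc_succ q \<theta>' (d, \<tau>) u com, abs_succ k q \<phi> \<psi> v \<phi>3 com) \<in> ?R"
    if "(conc_succ q \<theta>' (d, \<tau>) u com, abs_succ k q \<phi> \<psi> v \<phi>3 com) \<in> bisim_rel k d0 \<theta>0"
      "conc_succ q \<theta>' (d, \<tau>) u com \<in> rpds_ID k S" for q \<theta>' d \<tau> u com \<phi> \<psi> v \<phi>3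
    using that bisim_rel_in_pds_ID[where S' = S', OF _ _ S'(2)]
    by (cases com) (auto simp: rpds_ID_def)
  have "\<exists>c2'. pds_step (Phi k) S' c1' c2' \<and> (c2, c2') \<in> ?R"
    if step: "rpds_step k S c1 c2" and R: "(c1, c1') \<in> ?R" for c1 c2 c1'
  proof -
    obtain p \<theta> d \<tau> u q \<theta>' com where
      c: "c1 = (p, \<theta>, (d, \<tau>) # u)" "c2 = conc_succ q \<theta>' (d, \<tau>) u com" and ID: "c2 \<in> rpds_ID k S"
      and r: "(p, pattern k \<theta> d \<theta>', q, com) \<in> rules S"
      and fresh: "fresh_asg k \<theta> d ((d, \<tau>) # u) \<theta>'"
      using step unfolding rpds_step_iff by blast
    obtain p' \<phi> vv where c1': "c1' = ((p', \<phi>), vv)"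
      by (metis surj_pair)
    have R0: "((p, \<theta>, (d, \<tau>) # u), ((p', \<phi>), vv)) \<in> bisim_rel k d0 \<theta>0"
      using R unfolding c(1) c1' by (rule IntD1)
    obtain \<psi> v where *: "vv = \<psi> # v" "p = p'" "\<phi> = pattern k \<tau> d \<theta>"
      "\<psi> # v = patterns k d0 \<theta>0 \<tau> u" "composable k \<psi> \<phi>"
      "proper_stack k \<theta> ((d, \<tau>) # u)" "last ((d, \<tau>) # u) = (d0, \<theta>0)"
      using related[OF R0] by (elim exE conjE)
    let ?c2' = "abs_succ k q \<phi> \<psi> v (pattern k \<theta> d \<theta>') com"
    have c2': "(c2, ?c2') \<in> ?R"
      unfolding c(2) *(3) using ID unfolding c(2)
      by (rule succ_in[OF abs_succ_patterns[OF *(6,7) fresh rules(2)[OF r] *(4)]])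
    have "pds_step (Phi k) S' c1' ?c2'"
      unfolding pds_step_constr_iff[OF S']
    proof (intro conjI exI)
      show "c1' \<in> pds_ID (Phi k) S'" "?c2' \<in> pds_ID (Phi k) S'"
        using R c2' by simp_all
      show "c1' = ((p, \<phi>), \<psi> # v)"
        by (simp add: c1' *(1,2))
      show "composableT k \<phi> (pattern k \<theta> d \<theta>')"
        unfolding *(3) by (rule composableT_pattern)
    qed (rule refl r pattern_in_Phi *(5))+
    with c2' show ?thesis by blast
  qed
  moreover have "\<exists>c2. rpds_step k S c1 c2 \<and> (c2, c2') \<in> ?R"
    if step: "pds_step (Phi k) S' c1' c2'" and R: "(c1, c1') \<in> ?R" for c1 c1' c2'
  proof -
    obtain p \<phi> \<psi> v q \<phi>3 com where
      c: "c1' = ((p, \<phi>), \<psi> # v)" "c2' = abs_succ k q \<phi> \<psi> v \<phi>3 com"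
      and r: "(p, \<phi>3, q, com) \<in> rules S" and T: "composableT k \<phi> \<phi>3"
      using step unfolding pds_step_constr_iff[OF S'] by blast
    obtain p' \<theta> uu where c1: "c1 = (p', \<theta>, uu)"
      by (metis surj_pair)
    \<comment> \<open>The abstract stack is nonempty, hence so is the concrete one.\<close>
    have "length (\<phi> # \<psi> # v) = Suc (length uu)"
      using R unfolding c1 c(1) by (auto simp: bisim_rel_iff)
    then obtain d \<tau> u where uu: "uu = (d, \<tau>) # u"
      by (cases uu) auto
    have *: "p' = p" "\<phi> = pattern k \<tau> d \<theta>" "\<psi> # v = patterns k d0 \<theta>0 \<tau> u"
      "proper_stack k \<theta> ((d, \<tau>) # u)" "last ((d, \<tau>) # u) = (d0, \<theta>0)"
      using related[OF IntD1[OF R[unfolded c1 c(1) uu]]] by simp_all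
    obtain \<theta>' where \<theta>': "\<theta>' \<in> Theta k" "\<phi>3 = pattern k \<theta> d \<theta>'" "fresh_asg k \<theta> d ((d, \<tau>) # u) \<theta>'"
      using ex_fresh_asg[OF inf rules(3)[OF r]] T unfolding *(2) by metis
    let ?c2 = "conc_succ q \<theta>' (d, \<tau>) u com"
    have ID: "?c2 \<in> rpds_ID k S"
      using R rules(1)[OF r] \<theta>'(1) unfolding c1 uu by (cases com) (auto simp: rpds_ID_def)
    have "(?c2, c2') \<in> ?R"
      using succ_in[OF abs_succ_patterns[OF *(4,5) \<theta>'(3) rules(2)[OF r] *(3)] ID]
      unfolding c(2) *(2) \<theta>'(2) .
    moreover have "rpds_step k S c1 ?c2"
      unfolding rpds_step_iff
    proof (intro conjI exI)
      show "c1 \<in> rpds_ID k S"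
        using R by simp
      show "c1 = (p, \<theta>, (d, \<tau>) # u)"
        by (simp add: c1 uu *(1))
      show "(p, pattern k \<theta> d \<theta>', q, com) \<in> rules S"
        using r \<theta>'(2) by simp
    qed (rule refl ID \<theta>'(3))+
    ultimately show ?thesis by blast
  qed
  ultimately show ?thesis
    unfolding bisim_rpds_pds_def using S constr_is_pds[OF S S'] by blast
qed

section \<open>Acceptance and the automata\<close>

lemma lat_pattern: "sat' k \<theta>' (lat k (pattern k \<theta> d \<theta>'))"
  by (auto simp: sat'_def lat_def)

text \<open>\<open>sat'\<close> fixes \<psi> on the symbols \<open>X i\<close>, and
  \<open>Phi'\<close> admits no others. Since \<open>lat\<close> reads only the primed part,
  \<theta> and \<open>d\<close> may be arbitrary.\<close>

lemma sat'_unique: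
  assumes "\<psi> \<in> Phi' k" "sat' k \<theta>' \<psi>"
  shows "\<psi> = lat k (pattern k \<theta> d \<theta>')"
proof -
  have "\<psi> \<subseteq> X ` {1..k} \<times> X ` {1..k}"
    using assms(1) by (simp add: Phi'_def equiv_def)
  then show ?thesis
    using assms(2) by (auto simp: sat'_def lat_def)
qed

lemma constr_is_nfa:
  assumes "is_ra k A"
  shows "is_nfa (Phi k) (constr_nfa k A)"
proof -
  have A: "is_rpds k A" "init A \<subseteq> states A" "\<And>p \<phi> q c. (p, \<phi>, q, c) \<in> rules A \<Longrightarrow> c = Pop"
    using assms by (auto simp: is_ra_def)
  have "c = Pop" if "(p, g, q, c) \<in> constr_rules k A" for p g q c
    using that A(3) unfolding constr_rules_def by blast
  moreover have "is_pds (Phi k) (constr_nfa k A)"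
    by (rule constr_is_pds[OF A(1)]) (simp_all add: constr_nfa_def)
  ultimately show ?thesis
    using A(2) unfolding is_nfa_def by (auto simp: constr_nfa_def)
qed

text \<open>Related stacks have equal length, so both are empty or neither is. With empty stacks,
  \<phi> compares \<theta> with the fixed pair, and \<open>lat k \<phi>\<close> is exactly the
  equality type of \<theta>.\<close>

lemma constr_accept_iff:
  assumes A: "is_ra k A" and R: "(c, c') \<in> R_ra k d0 \<theta>0 A"
  shows "c \<in> Acc k A \<longleftrightarrow> (\<exists>q\<in>nfinal (constr_nfa k A). c' = (q, []))"
proof -
  obtain p \<theta> u q \<phi> v where c: "c = (p, \<theta>, u)" "c' = ((q, \<phi>), v)"
    by (metis surj_pair)
  have R': "p = q" "\<phi> # v = patterns k d0 \<theta>0 \<theta> u" "\<theta> \<in> Theta k" "p \<in> states A" "\<phi> \<in> Phi k"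
    using R by (auto simp: R_ra_def c bisim_rel_iff rpds_ID_def pds_ID_def constr_nfa_def)
  have len: "u = [] \<longleftrightarrow> v = []"
    using arg_cong[OF R'(2), of length] by auto
  show ?thesis
  proof (cases "u = []")
    case True
    then have \<phi>: "\<phi> = pattern k \<theta>0 d0 \<theta>"
      using R'(2) by simp
    have "(\<exists>\<psi>. (p, \<psi>) \<in> accept A \<and> sat' k \<theta> \<psi>) \<longleftrightarrow> (p, lat k \<phi>) \<in> accept A"
    proof
      assume "\<exists>\<psi>. (p, \<psi>) \<in> accept A \<and> sat' k \<theta> \<psi>"
      then obtain \<psi> where "(p, \<psi>) \<in> accept A" "sat' k \<theta> \<psi>" by blast
      moreover from this have "\<psi> \<in> Phi' k"
        using A by (auto simp: is_ra_def)
      ultimately show "(p, lat k \<phi>) \<in> accept A"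
        using sat'_unique \<phi> by metis
    next
      assume "(p, lat k \<phi>) \<in> accept A"
      then show "\<exists>\<psi>. (p, \<psi>) \<in> accept A \<and> sat' k \<theta> \<psi>"
        using lat_pattern \<phi> by metis
    qed
    then show ?thesis
      using True len R' by (auto simp: Acc_def constr_nfa_def c)
  next
    case False
    then show ?thesis
      using len by (auto simp: Acc_def c)
  qed
qed

theorem proposition4:
  fixes k :: nat and \<P> :: "'s rpds" and At :: "'a set" and \<A> :: "'a \<Rightarrow> 's ra"
    and c0 :: "('s, 'd::countable) rid" and d0 :: 'd and \<theta>0 :: "'d asg"
  assumes "infinite (UNIV :: 'd set)"
    and "is_rpds k \<P>"
    and "finite At"
    and "\<And>a. a \<in> At \<Longrightarrow> is_ra k (\<A> a) \<and> init (\<A> a) = states \<P>"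
    and "c0 \<in> rpds_ID k \<P>" and "proper k c0"
    and "snd (snd c0) \<noteq> []" and "last (snd (snd c0)) = (d0, \<theta>0)"
  shows "bisim_rpds_pds k (Phi k) \<P> (constr_pds k \<P>) (R_rpds k d0 \<theta>0 \<P>) \<and>
    (\<forall>a\<in>At. bisim_ra_nfa k (Phi k) (\<A> a) (constr_nfa k (\<A> a)) (R_ra k d0 \<theta>0 (\<A> a)))"
proof (intro conjI ballI)
  show "bisim_rpds_pds k (Phi k) \<P> (constr_pds k \<P>) (R_rpds k d0 \<theta>0 \<P>)"
    unfolding R_rpds_def
    by (rule constr_bisim[OF assms(1,2)]) (simp_all add: constr_pds_def)
  fix a assume "a \<in> At"
  then have A: "is_ra k (\<A> a)"
    using assms(4) by blast
  then have "is_rpds k (\<A> a)"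
    by (simp add: is_ra_def)
  \<comment> \<open>\<open>constr_bisim\<close> is polymorphic in the record extensions, so it
    applies to the RA and the NFA directly.\<close>
  then have "bisim_rpds_pds k (Phi k) (\<A> a) (constr_nfa k (\<A> a)) (R_ra k d0 \<theta>0 (\<A> a))"
    unfolding R_ra_def
    by (rule constr_bisim[OF assms(1)]) (simp_all add: constr_nfa_def)
  then show "bisim_ra_nfa k (Phi k) (\<A> a) (constr_nfa k (\<A> a)) (R_ra k d0 \<theta>0 (\<A> a))"
    unfolding bisim_ra_nfa_def
    using A constr_is_nfa[OF A]
    by (intro conjI ballI case_prodI2) (simp_all add: constr_accept_iff[OF A])
qed

end
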